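(* There exists an action $\Phi\in Act^1(F_2,S^2)$ of the free group $F_2$ on two generators $a,b$ on the two-dimensional sphere $S^2$ such that $\Phi$ is $C^0$-stable, $\Phi$ is $C^1$-stable, and $\Phi$ is not expansive.
   Context: Let $G=F_2$ be the free (discrete) group on $a,b$ with finite symmetric generating set $S=\{a,a^{-1},b,b^{-1}\}$, and let $X$ be a compact manifold with metric $d$ (here $X=S^2$). An action of $G$ on $X$ is a continuous map $\Phi:G\times X\to X$ with $\Phi(g_1,\Phi(g_2,x))=\Phi(g_1g_2,x)$ for all $g_1,g_2\in G$, $x\in X$, such that each $\Phi_g:X\to X$, $\Phi_g(x)=\Phi(g,x)$, is a homeomorphism. $Act(G,X)$ is the set of such actions, and $Act^1(G,X)$ is the set of $\Phi\in Act(G,X)$ such that $\Phi_s$ is of class $C^1$ for all $s\in S$. For maps $f,g:X\to X$ let $d_{C^0}(f,g)=\sup_{x\in X}d(f(x),g(x))$, and for $C^1$ maps let $d_{C^1}(f,g)=\max\{d_{C^0}(f,g),d_{C^0}(Df,Dg)\}$, where $d_{C^0}(Df,Dg)$ is the uniform ($C^0$) distance between the derivatives (i.e. $d_{C^1}$ is a standard $C^1$ distance). Put $d^0_S(\widetilde\Phi,\Phi)=\max_{s\in S}d_{C^0}(\widetilde\Phi_s,\Phi_s)$ for $\widetilde\Phi,\Phi\in Act(G,X)$ and $d^1_S(\widetilde\Phi,\Phi)=\max_{s\in S}d_{C^1}(\widetilde\Phi_s,\Phi_s)$ for $\widetilde\Phi,\Phi\in Act^1(G,X)$. $\Phi\in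 Act(G,X)$ is $C^0$-stable if for every $\varepsilon>0$ there exists $\delta>0$ such that for every $\widetilde\Phi\in Act(G,X)$ with $d^0_S(\widetilde\Phi,\Phi)<\delta$ there is a continuous surjective map $h:X\to X$ with $h\circ\widetilde\Phi_g=\Phi_g\circ h$ for every $g\in G$ and $d_{C^0}(h,\mathrm{id})<\varepsilon$. $\Phi\in Act^1(G,X)$ is $C^1$-stable if there exists $\delta>0$ such that for every $\widetilde\Phi\in Act^1(G,X)$ with $d^1_S(\widetilde\Phi,\Phi)<\delta$ there is a homeomorphism $h:X\to X$ with $h\circ\widetilde\Phi_g=\Phi_g\circ h$ for every $g\in G$. $\Phi\in Act(G,X)$ is expansive if there exists $\alpha>0$ such that for all $x,y\in X$ with $x\neq y$ there is $g\in G$ with $d(\Phi_g(x),\Phi_g(y))>\alpha$. *)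

theory Defs
  imports "HOL-Analysis.Analysis" "HOL-Algebra.Group"
begin

section \<open>The free group of rank two\<close>

datatype gen = Gen_a | Gen_b

text \<open>The letter \<open>(x, True)\<close> stands for the generator \<open>x\<close>, and \<open>(x, False)\<close> for its inverse.\<close>

type_synonym letter = "gen \<times> bool"

definition inv_letter :: "letter \<Rightarrow> letter" where
  "inv_letter l = (fst l, \<not> snd l)"

definition reduced_word :: "letter list \<Rightarrow> bool" where
  "reduced_word w \<longleftrightarrow> (\<forall>i. Suc i < length w \<longrightarrow> w ! Suc i \<noteq> inv_letter (w ! i))"

fun push :: "letter \<Rightarrow> letter list \<Rightarrow> letter list" where
  "push l [] = [l]"
| "push l (m # w) = (if m = inv_letter l then w else l # m # w)"

text \<open>Elements are reduced words; the product of \<open>u\<close> and \<open>v\<close> is the reduced form of the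
  concatenation \<open>u @ v\<close>.\<close>

definition F2 :: "letter list monoid" where
  "F2 = \<lparr>carrier = {w. reduced_word w}, mult = (\<lambda>u v. foldr push u v), one = []\<rparr>"

definition S_F2 :: "letter list set" where
  "S_F2 = {[(Gen_a, True)], [(Gen_a, False)], [(Gen_b, True)], [(Gen_b, False)]}"

lemma inv_letter_inv_letter [simp]: "inv_letter (inv_letter l) = l"
  by (simp add: inv_letter_def)

lemma inv_letter_neq [simp]: "inv_letter l \<noteq> l" "l \<noteq> inv_letter l"
  by (cases l; auto simp: inv_letter_def)+

lemma reduced_Nil [simp]: "reduced_word []"
  by (simp add: reduced_word_def)

lemma reduced_single [simp]: "reduced_word [l]"
  by (simp add: reduced_word_def)

lemma reduced_Cons_Cons [simp]:
  "reduced_word (l # m # w) \<longleftrightarrow> m \<noteq> inv_letter l \<and> reduced_word (m # w)"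
proof
  assume *: "reduced_word (l # m # w)"
  have "m \<noteq> inv_letter l"
    using *[unfolded reduced_word_def, rule_format, of 0] by simp
  moreover have "reduced_word (m # w)"
    unfolding reduced_word_def
  proof (intro allI impI)
    fix i assume "Suc i < length (m # w)"
    then show "(m # w) ! Suc i \<noteq> inv_letter ((m # w) ! i)"
      using *[unfolded reduced_word_def, rule_format, of "Suc i"] by simp
  qed
  ultimately show "m \<noteq> inv_letter l \<and> reduced_word (m # w)" by simp
next
  assume *: "m \<noteq> inv_letter l \<and> reduced_word (m # w)"
  show "reduced_word (l # m # w)"
    unfolding reduced_word_def
  proof (intro allI impI)
    fix i assume "Suc i < length (l # m # w)"
    then show "(l # m # w) ! Suc i \<noteq> inv_letter ((l # m # w) ! i)"
      using * by (cases i) (auto simp: reduced_word_def)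
  qed
qed

lemma reduced_ConsD: "reduced_word (l # w) \<Longrightarrow> reduced_word w"
  by (cases w) auto

lemma reduced_push: "reduced_word w \<Longrightarrow> reduced_word (push l w)"
  by (cases w) (auto dest: reduced_ConsD)

lemma reduced_foldr_push: "reduced_word w \<Longrightarrow> reduced_word (foldr push u w)"
  by (induction u) (auto intro: reduced_push)

lemma push_reduced: "reduced_word (l # w) \<Longrightarrow> push l w = l # w"
  by (cases w) auto

lemma push_inv_letter: "reduced_word w \<Longrightarrow> push l (push (inv_letter l) w) = w"
  by (cases w) (auto simp: push_reduced)

lemma foldr_push_push:
  assumes "reduced_word w"
  shows "foldr push (push l u) w = push l (foldr push u w)"
proof (cases u)
  case (Cons m v)
  then show ?thesis
    using push_inv_letter[OF reduced_foldr_push[OF assms, of v], of l] by auto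
qed simp

lemma foldr_push_assoc:
  "reduced_word w \<Longrightarrow> foldr push (foldr push u v) w = foldr push u (foldr push v w)"
  by (induction u) (simp_all add: foldr_push_push)

lemma foldr_push_Nil: "reduced_word w \<Longrightarrow> foldr push w [] = w"
proof (induction w)
  case (Cons l w)
  then show ?case
    using push_reduced[OF Cons.prems] reduced_ConsD[OF Cons.prems] by simp
qed simp

lemma foldr_push_inv:
  "reduced_word w \<Longrightarrow> foldr push (rev (map inv_letter u)) (foldr push u w) = w"
proof (induction u)
  case (Cons l u)
  then show ?case
    using push_inv_letter[OF reduced_foldr_push[OF Cons.prems, of u], of "inv_letter l"] by simp
qed simp

lemma group_F2: "group F2"
proof (rule groupI)
  fix x assume x: "x \<in> carrier F2"
  define y where "y = foldr push (rev (map inv_letter x)) []"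
  have y: "y \<in> carrier F2"
    by (simp add: F2_def y_def reduced_foldr_push)
  have "foldr push y x = foldr push (rev (map inv_letter x)) (foldr push [] x)"
    using x unfolding y_def by (intro foldr_push_assoc) (simp add: F2_def)
  also have "\<dots> = foldr push (rev (map inv_letter x)) (foldr push x [])"
    using x by (simp add: F2_def foldr_push_Nil)
  also have "\<dots> = []"
    by (rule foldr_push_inv) simp
  finally show "\<exists>y\<in>carrier F2. y \<otimes>\<^bsub>F2\<^esub> x = \<one>\<^bsub>F2\<^esub>"
    using y by (intro bexI[of _ y]) (simp_all add: F2_def)
qed (auto simp: F2_def reduced_foldr_push foldr_push_assoc)

definition eval_letter :: "('h, 'm) monoid_scheme \<Rightarrow> (gen \<Rightarrow> 'h) \<Rightarrow> letter \<Rightarrow> 'h" where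
  "eval_letter H f l = (if snd l then f (fst l) else inv\<^bsub>H\<^esub> f (fst l))"

definition eval_word :: "('h, 'm) monoid_scheme \<Rightarrow> (gen \<Rightarrow> 'h) \<Rightarrow> letter list \<Rightarrow> 'h" where
  "eval_word H f w = foldr (\<lambda>l h. eval_letter H f l \<otimes>\<^bsub>H\<^esub> h) w \<one>\<^bsub>H\<^esub>"

lemma F2_universal_property:
  assumes "group H" and f: "\<And>x. f x \<in> carrier H"
  shows "\<exists>\<phi>\<in>hom F2 H. (\<forall>x. \<phi> [(x, True)] = f x) \<and>
           (\<forall>\<psi>\<in>hom F2 H. (\<forall>x. \<psi> [(x, True)] = f x) \<longrightarrow> (\<forall>w\<in>carrier F2. \<psi> w = \<phi> w))"
proof -
  interpret H: group H by fact
  let ?\<phi> = "eval_word H f"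
  have el: "eval_letter H f l \<in> carrier H" for l
    using f by (simp add: eval_letter_def)
  have inv_el: "eval_letter H f l \<otimes>\<^bsub>H\<^esub> eval_letter H f (inv_letter l) = \<one>\<^bsub>H\<^esub>" for l
    using f by (simp add: eval_letter_def inv_letter_def)
  have closed: "?\<phi> w \<in> carrier H" for w
    by (induction w) (simp_all add: eval_word_def el)
  have Cons: "?\<phi> (l # w) = eval_letter H f l \<otimes>\<^bsub>H\<^esub> ?\<phi> w" for l w
    by (simp add: eval_word_def)
  have push: "?\<phi> (push l w) = eval_letter H f l \<otimes>\<^bsub>H\<^esub> ?\<phi> w" for l w
  proof (cases w)
    case (Cons m v)
    then show ?thesis
      by (auto simp: \<open>\<And>l w. ?\<phi> (l # w) = _\<close> inv_el el closed simp flip: H.m_assoc)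
  qed (simp add: Cons)
  have mult: "?\<phi> (foldr push u w) = ?\<phi> u \<otimes>\<^bsub>H\<^esub> ?\<phi> w" for u w
  proof (induction u)
    case Nil
    have "?\<phi> [] = \<one>\<^bsub>H\<^esub>" by (simp add: eval_word_def)
    then show ?case by (simp add: closed)
  next
    case (Cons l u)
    then show ?case by (simp add: push \<open>\<And>l w. ?\<phi> (l # w) = _\<close> el closed H.m_assoc)
  qed
  have hom: "?\<phi> \<in> hom F2 H"
    by (rule homI) (simp_all add: F2_def closed mult)
  have gens: "?\<phi> [(x, True)] = f x" for x
    by (simp add: eval_word_def eval_letter_def f)
  have uniq: "\<psi> w = ?\<phi> w"
    if \<psi>: "\<psi> \<in> hom F2 H" and \<psi>f: "\<forall>x. \<psi> [(x, True)] = f x" and w: "w \<in> carrier F2" for \<psi> w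
  proof -
    interpret \<psi>: group_hom F2 H \<psi>
      using \<psi> group_F2 \<open>group H\<close> by (simp add: group_hom_def group_hom_axioms_def)
    have one: "\<psi> [] = \<one>\<^bsub>H\<^esub>"
      using \<psi>.hom_one by (simp add: F2_def)
    have letter: "\<psi> [l] = eval_letter H f l" for l
    proof (cases "snd l")
      case True
      then show ?thesis
        using \<psi>f by (cases l) (simp add: eval_letter_def)
    next
      case False
      then obtain x where l: "l = (x, False)" by (cases l) auto
      have "\<psi> [(x, False)] \<otimes>\<^bsub>H\<^esub> \<psi> [(x, True)] = \<psi> ([(x, False)] \<otimes>\<^bsub>F2\<^esub> [(x, True)])"
        by (rule \<psi>.hom_mult[symmetric]) (simp_all add: F2_def)
      also have "\<dots> = \<one>\<^bsub>H\<^esub>"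
        by (simp add: F2_def inv_letter_def one)
      finally have "\<psi> [(x, False)] \<otimes>\<^bsub>H\<^esub> f x = \<one>\<^bsub>H\<^esub>"
        using \<psi>f by simp
      moreover have "\<psi> [(x, False)] \<in> carrier H"
        by (rule \<psi>.hom_closed) (simp add: F2_def)
      ultimately have "inv\<^bsub>H\<^esub> (f x) = \<psi> [(x, False)]"
        using f by (intro H.inv_equality) auto
      then show ?thesis by (simp add: l eval_letter_def)
    qed
    have "reduced_word w \<Longrightarrow> \<psi> w = ?\<phi> w"
    proof (induction w)
      case Nil
      then show ?case by (simp add: one eval_word_def)
    next
      case (Cons l w)
      have "\<psi> (l # w) = \<psi> ([l] \<otimes>\<^bsub>F2\<^esub> w)"
        using Cons.prems by (simp add: F2_def push_reduced)
      also have "\<dots> = \<psi> [l] \<otimes>\<^bsub>H\<^esub> \<psi> w"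
        using Cons.prems by (intro \<psi>.hom_mult) (auto simp: F2_def dest: reduced_ConsD)
      also have "\<dots> = ?\<phi> (l # w)"
        using Cons by (simp add: letter \<open>\<And>l w. ?\<phi> (l # w) = _\<close> reduced_ConsD)
      finally show ?case .
    qed
    then show ?thesis using w by (simp add: F2_def)
  qed
  show ?thesis
    using hom gens uniq by (intro bexI[of _ ?\<phi>]) auto
qed

section \<open>Actions by homeomorphisms\<close>

text \<open>Maps of \<open>X\<close> are total functions on the ambient type, of which only the values on \<open>X\<close> are
  ever used.\<close>

definition Act :: "('g, 'm) monoid_scheme \<Rightarrow> 'x::metric_space set \<Rightarrow> ('g \<Rightarrow> 'x \<Rightarrow> 'x) set" where
  "Act G X = {\<Phi>.
     continuous_map (prod_topology (discrete_topology (carrier G)) (top_of_set X)) (top_of_set X)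
       (\<lambda>(g, x). \<Phi> g x) \<and>
     (\<forall>g1\<in>carrier G. \<forall>g2\<in>carrier G. \<forall>x\<in>X. \<Phi> g1 (\<Phi> g2 x) = \<Phi> (g1 \<otimes>\<^bsub>G\<^esub> g2) x) \<and>
     (\<forall>g\<in>carrier G. \<exists>k. homeomorphism X X (\<Phi> g) k)}"

definition d_C0 :: "'x::metric_space set \<Rightarrow> ('x \<Rightarrow> 'x) \<Rightarrow> ('x \<Rightarrow> 'x) \<Rightarrow> real" where
  "d_C0 X f g = (SUP x\<in>X. dist (f x) (g x))"

definition d0 :: "'g set \<Rightarrow> 'x::metric_space set \<Rightarrow> ('g \<Rightarrow> 'x \<Rightarrow> 'x) \<Rightarrow> ('g \<Rightarrow> 'x \<Rightarrow> 'x) \<Rightarrow> real" where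
  "d0 S X \<Psi> \<Phi> = Max ((\<lambda>s. d_C0 X (\<Psi> s) (\<Phi> s)) ` S)"

definition C0_stable ::
  "('g, 'm) monoid_scheme \<Rightarrow> 'g set \<Rightarrow> 'x::metric_space set \<Rightarrow> ('g \<Rightarrow> 'x \<Rightarrow> 'x) \<Rightarrow> bool" where
  "C0_stable G S X \<Phi> \<longleftrightarrow>
     (\<forall>\<epsilon>>0. \<exists>\<delta>>0. \<forall>\<Psi>\<in>Act G X. d0 S X \<Psi> \<Phi> < \<delta> \<longrightarrow>
        (\<exists>h. continuous_on X h \<and> h ` X = X \<and>
             (\<forall>g\<in>carrier G. \<forall>x\<in>X. h (\<Psi> g x) = \<Phi> g (h x)) \<and>
             d_C0 X h id < \<epsilon>))"

definition expansive ::
  "('g, 'm) monoid_scheme \<Rightarrow> 'x::metric_space set \<Rightarrow> ('g \<Rightarrow> 'x \<Rightarrow> 'x) \<Rightarrow> bool" where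
  "expansive G X \<Phi> \<longleftrightarrow>
     (\<exists>\<alpha>>0. \<forall>x\<in>X. \<forall>y\<in>X. x \<noteq> y \<longrightarrow> (\<exists>g\<in>carrier G. dist (\<Phi> g x) (\<Phi> g y) > \<alpha>))"

section \<open>Continuously differentiable actions on the sphere\<close>

definition S2 :: "(real^3) set" where
  "S2 = sphere 0 1"

text \<open>Class \<open>C\<^sup>1\<close> on an embedded submanifold of Euclidean space: \<open>f\<close> extends, near each point, to a
  \<open>C\<^sup>1\<close> map on an open subset of the ambient space.\<close>

definition C1_on :: "'x::euclidean_space set \<Rightarrow> ('x \<Rightarrow> 'x) \<Rightarrow> bool" where
  "C1_on X f \<longleftrightarrow>
     (\<forall>x\<in>X. \<exists>U F. \<exists>F' :: 'x \<Rightarrow> 'x \<Rightarrow>\<^sub>L 'x. open U \<and> x \<in> U \<and>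
        (\<forall>y\<in>U. (F has_derivative blinfun_apply (F' y)) (at y)) \<and> continuous_on U F' \<and>
        (\<forall>y\<in>U \<inter> X. F y = f y))"

definition unit_tangent_S2 :: "((real^3) \<times> (real^3)) set" where
  "unit_tangent_S2 = {(x, v). x \<in> S2 \<and> x \<bullet> v = 0 \<and> norm v = 1}"

text \<open>The derivative within \<open>S2\<close> is determined on tangent vectors only, see
  \<open>S2_derivative_unique\<close> below; hence the supremum over unit tangent vectors.\<close>

definition d_C0_deriv :: "(real^3 \<Rightarrow> real^3) \<Rightarrow> (real^3 \<Rightarrow> real^3) \<Rightarrow> real" where
  "d_C0_deriv f g =
     (SUP (x, v)\<in>unit_tangent_S2.
        dist (frechet_derivative f (at x within S2) v) (frechet_derivative g (at x within S2) v))"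

definition d_C1 :: "(real^3 \<Rightarrow> real^3) \<Rightarrow> (real^3 \<Rightarrow> real^3) \<Rightarrow> real" where
  "d_C1 f g = max (d_C0 S2 f g) (d_C0_deriv f g)"

definition Act1 :: "('g, 'm) monoid_scheme \<Rightarrow> 'g set \<Rightarrow> ('g \<Rightarrow> real^3 \<Rightarrow> real^3) set" where
  "Act1 G S = {\<Phi> \<in> Act G S2. \<forall>s\<in>S. C1_on S2 (\<Phi> s)}"

definition d1 :: "'g set \<Rightarrow> ('g \<Rightarrow> real^3 \<Rightarrow> real^3) \<Rightarrow> ('g \<Rightarrow> real^3 \<Rightarrow> real^3) \<Rightarrow> real" where
  "d1 S \<Psi> \<Phi> = Max ((\<lambda>s. d_C1 (\<Psi> s) (\<Phi> s)) ` S)"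

definition C1_stable ::
  "('g, 'm) monoid_scheme \<Rightarrow> 'g set \<Rightarrow> ('g \<Rightarrow> real^3 \<Rightarrow> real^3) \<Rightarrow> bool" where
  "C1_stable G S \<Phi> \<longleftrightarrow>
     (\<exists>\<delta>>0. \<forall>\<Psi>\<in>Act1 G S. d1 S \<Psi> \<Phi> < \<delta> \<longrightarrow>
        (\<exists>h k. homeomorphism S2 S2 h k \<and>
               (\<forall>g\<in>carrier G. \<forall>x\<in>S2. h (\<Psi> g x) = \<Phi> g (h x))))"

lemma S2_derivative_unique:
  assumes D: "(f has_derivative D) (at x within S2)" and xv: "(x, v) \<in> unit_tangent_S2"
  shows "frechet_derivative f (at x within S2) v = D v"
proof -
  define c where "c = (\<lambda>t::real. cos t *\<^sub>R x + sin t *\<^sub>R v)"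
  have c_S2: "c t \<in> S2" for t
  proof -
    have "x \<bullet> x = 1" "v \<bullet> v = 1" "x \<bullet> v = 0" "v \<bullet> x = 0"
      using xv by (auto simp: unit_tangent_S2_def S2_def dot_square_norm inner_commute)
    then have "c t \<bullet> c t = (cos t)\<^sup>2 + (sin t)\<^sup>2"
      by (simp add: c_def inner_add_left inner_add_right power2_eq_square)
    then show ?thesis
      by (simp add: S2_def norm_eq_1)
  qed
  have c': "(c has_vector_derivative v) (at 0)"
    unfolding c_def by (auto intro!: derivative_eq_intros)
  have *: "(f \<circ> c has_vector_derivative E v) (at 0)" if E: "(f has_derivative E) (at x within S2)" for E
  proof -
    interpret E: bounded_linear E using E by (rule has_derivative_bounded_linear)
    have "(f has_derivative E) (at (c 0) within range c)"
      using has_derivative_subset[OF E, of "range c"] c_S2 by (auto simp: c_def)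
    from diff_chain_within[OF c'[unfolded has_vector_derivative_def] this]
    show ?thesis
      by (simp add: has_vector_derivative_def o_def E.scaleR)
  qed
  have "(f has_derivative frechet_derivative f (at x within S2)) (at x within S2)"
    using D by (metis differentiable_def frechet_derivative_works)
  from vector_derivative_unique_at[OF *[OF this] *[OF D]] show ?thesis .
qed

lemma C1_on_imp_differentiable:
  assumes "C1_on X f" "x \<in> X"
  shows "f differentiable (at x within X)"
proof -
  obtain U F and F' :: "'a \<Rightarrow> 'a \<Rightarrow>\<^sub>L 'a" where U: "open U" "x \<in> U"
    and F: "\<And>y. y \<in> U \<Longrightarrow> (F has_derivative blinfun_apply (F' y)) (at y)"
    and Ff: "\<And>y. y \<in> U \<inter> X \<Longrightarrow> F y = f y"
    using assms unfolding C1_on_def by meson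
  have "(F has_derivative F' x) (at x within X)"
    using F[OF U(2)] by (rule has_derivative_at_withinI)
  moreover obtain e where "0 < e" "ball x e \<subseteq> U"
    using U by (meson openE)
  ultimately have "(f has_derivative F' x) (at x within X)"
    using assms(2) Ff
    by (intro has_derivative_transform_within[of F "F' x" x X e f])
      (auto simp: subset_iff dist_commute)
  then show ?thesis by (auto simp: differentiable_def)
qed

end

(*
  A classical Schottky group generated by hyperbolic translations along two orthogonal axes. The
  four caps are disjoint, and each generator maps the complement of one cap onto another one.
  Points of the common complement D of the caps are never expanded by reduced words, so the action
  is not expansive. A nearby action has nearby caps with the same combinatorics. Prescribing the
  conjugacy h close to the identity near D, compatibly along the boundary circles, it extends
  to the whole sphere as the fixed point of h = phi_m o h o psi_m^-1 on the cap of m; this converges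
  because phi_m contracts the caps other than that of m^-1. Being close to the identity, h is onto. For
  C1-small perturbations the inverse generators expand on the caps and the prescribed map is
  injective near D, so h is injective.
*)

theory Submission
  imports Defs
begin

text \<open>The hyperbolic tangent of half the translation length is 4/5, so all data are rational,
  and 2 * (4/5)^2 > 1 separates the caps around orthogonal directions with room to spare. The
  obstacle is the isometric circle, where the conformal factor of \<open>\<phi> m\<close> is exactly
  1: the recursion is no uniform contraction on all maps near the identity. It becomes one on maps
  that agree with \<open>h0\<close> on the neighbourhood \<open>N\<close> of the fundamental domain.
  A pull-back in the domain contributes no difference, and a pull-back in another cap is far from
  the circle, where the factor is at most 9/13. For one step to preserve this agreement,
  \<open>h0\<close> has to be compatible near the boundary circles and not only on them. As
  C0-closeness says nothing about derivatives of \<psi>, all contraction is taken from \<phi>. The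
  conjugacy moves points by at most 50\<delta>, so points with the same image are 100\<delta>-close;
  \<delta> \<le> 1/20000 makes this at most 1/200 = 81/100 - 805/1000, the margin between the
  fundamental domain and the edge of \<open>N\<close>.\<close>

declare split_paired_All [simp del] split_paired_Ex [simp del]

section \<open>Hyperbolic translations of the sphere\<close>

text \<open>The restriction to the unit sphere of a hyperbolic translation along the axis \<open>u\<close>, with
  \<open>cosh = 41/9\<close> and \<open>sinh = 40/9\<close>. It maps the outside of the cap \<open>x \<bullet> u \<le> -4/5\<close> onto the cap
  \<open>x \<bullet> u > 4/5\<close>, and \<open>x \<bullet> u = -4/5\<close> is its isometric circle.\<close>

definition boost :: "'a::real_inner \<Rightarrow> 'a \<Rightarrow> 'a" where
  "boost u x = (1 / (41 + 40 * (x \<bullet> u))) *\<^sub>R (9 *\<^sub>R x + (32 * (x \<bullet> u) + 40) *\<^sub>R u)"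

lemma inner_unit_ge: "norm x = 1 \<Longrightarrow> norm u = 1 \<Longrightarrow> - 1 \<le> x \<bullet> u"
  using Cauchy_Schwarz_ineq2[of x u] by simp

lemma inner_unit_le: "norm x = 1 \<Longrightarrow> norm u = 1 \<Longrightarrow> x \<bullet> u \<le> 1"
  using Cauchy_Schwarz_ineq2[of x u] by simp

text \<open>Lorentz invariance: \<open>1 - x \<bullet> y\<close> is the Minkowski product of the
  light-like vectors (1, x) and (1, y), which a boost preserves; normalizing divides by the time
  coordinates \<open>(41 + 40 * (x \<bullet> u)) / 9\<close>. Squared chords thus scale exactly by
  the product of the conformal factors at both ends, and \<open>x = y\<close> gives invariance of
  the sphere.\<close>

lemma boost_inner_boost:
  assumes "norm u = 1" "norm x = 1" "norm y = 1"
  shows "boost u x \<bullet> boost u y = 1 - 81 * (1 - x \<bullet> y) / ((41 + 40 * (x \<bullet> u)) * (41 + 40 * (y \<bullet> u)))"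
proof -
  define p q where "p = x \<bullet> u" and "q = y \<bullet> u"
  have "- 1 \<le> p" "- 1 \<le> q"
    unfolding p_def q_def using assms by (simp_all add: inner_unit_ge)
  then have nz: "41 + 40 * p \<noteq> 0" "41 + 40 * q \<noteq> 0"
    by linarith+
  have uu: "u \<bullet> u = 1" using assms by (simp add: dot_square_norm)
  have "(9 *\<^sub>R x + (32 * p + 40) *\<^sub>R u) \<bullet> (9 *\<^sub>R y + (32 * q + 40) *\<^sub>R u)
      = 81 * (x \<bullet> y) + 9 * p * (32 * q + 40) + 9 * q * (32 * p + 40) + (32 * p + 40) * (32 * q + 40)"
    by (simp add: inner_add_left inner_add_right inner_commute[of u y] uu p_def[symmetric] q_def[symmetric])
      (simp add: algebra_simps)
  also have "\<dots> = (41 + 40 * p) * (41 + 40 * q) - 81 * (1 - x \<bullet> y)"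
    by algebra
  finally have "boost u x \<bullet> boost u y
      = ((41 + 40 * p) * (41 + 40 * q) - 81 * (1 - x \<bullet> y)) / ((41 + 40 * p) * (41 + 40 * q))"
    by (simp add: boost_def p_def[symmetric] q_def[symmetric])
  then show ?thesis
    using nz by (simp add: diff_divide_distrib p_def[symmetric] q_def[symmetric])
qed

lemma norm_boost [simp]:
  assumes "norm u = 1" "norm x = 1"
  shows "norm (boost u x) = 1"
  using boost_inner_boost[OF assms assms(2)] assms by (simp add: norm_eq_1)

lemma boost_inner:
  assumes "norm u = 1" "norm x = 1"
  shows "boost u x \<bullet> u = (41 * (x \<bullet> u) + 40) / (41 + 40 * (x \<bullet> u))"
proof -
  have "u \<bullet> u = 1" using assms by (simp add: dot_square_norm)
  then show ?thesis
    by (simp add: boost_def inner_add_left)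
qed

lemma boost_minus_boost:
  assumes "norm u = 1" "norm x = 1"
  shows "boost (- u) (boost u x) = x"
proof -
  define p where "p = x \<bullet> u"
  have "- 1 \<le> p"
    unfolding p_def using assms by (simp add: inner_unit_ge)
  then have pos: "41 + 40 * p > 0"
    by linarith
  have 1: "41 + 40 * (boost u x \<bullet> - u) = 81 / (41 + 40 * p)"
    using pos by (simp add: boost_inner[OF assms] p_def[symmetric] field_simps)
  have 2: "32 * (boost u x \<bullet> - u) + 40 = (288 * p + 360) / (41 + 40 * p)"
    using pos by (simp add: boost_inner[OF assms] p_def[symmetric] field_simps)
  have "boost (- u) (boost u x)
      = ((41 + 40 * p) / 81) *\<^sub>R (9 *\<^sub>R boost u x - ((288 * p + 360) / (41 + 40 * p)) *\<^sub>R u)"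
    by (subst boost_def) (simp only: 1 2, simp)
  also have "9 *\<^sub>R boost u x = (81 / (41 + 40 * p)) *\<^sub>R x + ((288 * p + 360) / (41 + 40 * p)) *\<^sub>R u"
    by (simp add: boost_def p_def[symmetric] scaleR_add_right)
  finally show ?thesis
    using pos by simp
qed

lemma norm_diff_unit_sq:
  assumes "norm x = 1" "norm y = 1"
  shows "(norm (x - y))\<^sup>2 = 2 * (1 - x \<bullet> y)"
  using assms by (simp add: dot_square_norm[symmetric] inner_diff_left inner_diff_right
      inner_commute[of y x] norm_eq_1)

lemma dist_boost_le:
  assumes "norm u = 1" "norm x = 1" "norm y = 1"
    and "r \<le> 41 + 40 * (x \<bullet> u)" "r \<le> 41 + 40 * (y \<bullet> u)" "r > 0"
  shows "dist (boost u x) (boost u y) \<le> 9 / r * dist x y"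
proof -
  let ?q = "(41 + 40 * (x \<bullet> u)) * (41 + 40 * (y \<bullet> u))"
  have "r\<^sup>2 \<le> ?q"
    unfolding power2_eq_square using assms by (intro mult_mono) auto
  moreover have "(dist (boost u x) (boost u y))\<^sup>2 = 81 * (dist x y)\<^sup>2 / ?q"
    using assms by (simp add: dist_norm norm_diff_unit_sq boost_inner_boost)
  moreover have "81 * (dist x y)\<^sup>2 / ?q \<le> 81 * (dist x y)\<^sup>2 / r\<^sup>2"
    using \<open>r\<^sup>2 \<le> ?q\<close> assms(4-6) by (intro divide_left_mono mult_pos_pos) auto
  ultimately have "(dist (boost u x) (boost u y))\<^sup>2 \<le> 81 * (dist x y)\<^sup>2 / r\<^sup>2"
    by simp
  also have "\<dots> = (9 / r * dist x y)\<^sup>2"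
    by (simp add: power_divide power_mult_distrib)
  finally show ?thesis
    by (rule power2_le_imp_le) (use assms(6) in auto)
qed

section \<open>The four letter maps and the position of their caps\<close>

definition dir :: "letter \<Rightarrow> real^3" where
  "dir l = (if snd l then 1 else - 1) *\<^sub>R axis (case fst l of Gen_a \<Rightarrow> 1 | Gen_b \<Rightarrow> 2) 1"

abbreviation il :: "letter \<Rightarrow> letter" where "il \<equiv> inv_letter"

lemma norm_dir [simp]: "norm (dir l) = 1"
  by (simp add: dir_def norm_axis_1)

lemma dir_il [simp]: "dir (il l) = - dir l"
  by (simp add: dir_def inv_letter_def)

lemma inner_dir_orth: "fst l \<noteq> fst m \<Longrightarrow> dir l \<bullet> dir m = 0"
  by (cases "fst l"; cases "fst m") (auto simp: dir_def inner_axis_axis)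

definition \<phi> :: "letter \<Rightarrow> real^3 \<Rightarrow> real^3" where
  "\<phi> l = boost (dir l)"

lemma S2_norm: "x \<in> S2 \<longleftrightarrow> norm x = 1"
  by (simp add: S2_def)

lemma \<phi>_S2 [simp]: "x \<in> S2 \<Longrightarrow> \<phi> l x \<in> S2"
  by (simp add: S2_norm \<phi>_def)

lemma \<phi>_il [simp]: "x \<in> S2 \<Longrightarrow> \<phi> (il l) (\<phi> l x) = x"
  by (simp add: S2_norm \<phi>_def boost_minus_boost)

lemma \<phi>_il2 [simp]: "x \<in> S2 \<Longrightarrow> \<phi> l (\<phi> (il l) x) = x"
  using \<phi>_il[of x "il l"] by simp

lemma inner_perp_bound:
  assumes "norm x = 1" "norm u = 1" "norm v = 1" "u \<bullet> v = 0"
  shows "(x \<bullet> u)\<^sup>2 + (x \<bullet> v)\<^sup>2 \<le> 1"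
proof -
  define y where "y = x - (x \<bullet> u) *\<^sub>R u - (x \<bullet> v) *\<^sub>R v"
  have e: "x \<bullet> x = 1" "u \<bullet> u = 1" "v \<bullet> v = 1" "u \<bullet> v = 0" "v \<bullet> u = 0"
    using assms by (simp_all add: dot_square_norm inner_commute)
  have "y \<bullet> y = 1 - (x \<bullet> u)\<^sup>2 - (x \<bullet> v)\<^sup>2"
    by (simp add: y_def inner_diff_left inner_diff_right e power2_eq_square inner_commute[of u x] inner_commute[of v x])
  moreover have "0 \<le> y \<bullet> y" by simp
  ultimately show ?thesis by linarith
qed

lemma \<phi>_inner:
  "x \<in> S2 \<Longrightarrow> \<phi> l x \<bullet> dir l = (41 * (x \<bullet> dir l) + 40) / (41 + 40 * (x \<bullet> dir l))"
  by (simp add: \<phi>_def S2_norm boost_inner)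

lemma dir_inner_ge: "x \<in> S2 \<Longrightarrow> - 1 \<le> x \<bullet> dir l"
  by (simp add: S2_norm inner_unit_ge)

lemma dist_\<phi>_le:
  assumes "x \<in> S2" "y \<in> S2" "c \<le> x \<bullet> dir l" "c \<le> y \<bullet> dir l" "- 1 \<le> c"
  shows "dist (\<phi> l x) (\<phi> l y) \<le> 9 / (41 + 40 * c) * dist x y"
  unfolding \<phi>_def by (rule dist_boost_le) (use assms in \<open>auto simp: S2_norm\<close>)

text \<open>The squares of 78/100 and 63/100 add up to slightly more than 1, which contradicts
  Bessel's inequality for orthogonal directions; the only other direction is the antipode.\<close>

lemma inner_other_dir:
  assumes x: "x \<in> S2" "78 / 100 < x \<bullet> dir l" and "m \<noteq> l"
  shows "x \<bullet> dir m < 63 / 100"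
proof (cases "fst m = fst l")
  case True
  then have "m = inv_letter l"
    using \<open>m \<noteq> l\<close> by (cases m; cases l) (auto simp: inv_letter_def)
  then show ?thesis using x by simp
next
  case False
  show ?thesis
  proof (rule ccontr)
    assume "\<not> x \<bullet> dir m < 63 / 100"
    then have "(63 / 100)\<^sup>2 \<le> (x \<bullet> dir m)\<^sup>2"
      by (intro power_mono) auto
    moreover have "(78 / 100)\<^sup>2 \<le> (x \<bullet> dir l)\<^sup>2"
      using x by (intro power_mono) auto
    moreover have "(x \<bullet> dir m)\<^sup>2 + (x \<bullet> dir l)\<^sup>2 \<le> 1"
      using x inner_dir_orth[OF False] by (intro inner_perp_bound) (auto simp: S2_norm)
    ultimately show False
      by (simp add: power2_eq_square)
  qed
qed

lemma continuous_on_\<phi>: "continuous_on S2 (\<phi> l)"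
proof -
  have "41 + 40 * (x \<bullet> dir l) \<noteq> 0" if "x \<in> S2" for x
    using inner_unit_ge[of x "dir l"] that by (auto simp: S2_norm)
  then show ?thesis
    unfolding \<phi>_def boost_def by (auto intro!: continuous_intros)
qed

section \<open>Semiconjugacy with a perturbation\<close>

lemma continuous_on_local:
  fixes f :: "'a::t2_space \<Rightarrow> 'b::topological_space"
  assumes "\<And>x. x \<in> S \<Longrightarrow> \<exists>U. open U \<and> x \<in> U \<and> continuous_on (S \<inter> U) f"
  shows "continuous_on S f"
  unfolding continuous_on_eq_continuous_within
proof
  fix x assume x: "x \<in> S"
  then obtain U where U: "open U" "x \<in> U" "continuous_on (S \<inter> U) f"
    using assms by blast
  then have "continuous (at x within S \<inter> U) f"
    using x by (simp add: continuous_on_eq_continuous_within)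
  moreover have "at x within S \<inter> U = at x within S"
    by (rule at_within_nhd[OF U(2,1)]) blast
  ultimately show "continuous (at x within S) f" by simp
qed

text \<open>\<open>sgn\<close> is the radial projection to the sphere. It moves \<open>x + e\<close>
  by the defect of its norm from 1, at most \<open>norm e\<close>; the other \<open>norm e\<close>
  is the displacement of \<open>x\<close> before projecting.\<close>

lemma dist_sgn_le:
  fixes x e :: "'a::real_normed_vector"
  assumes "norm x = 1" "norm e < 1"
  shows "dist (sgn (x + e)) x \<le> 2 * norm e"
proof -
  let ?p = "x + e"
  have p: "\<bar>norm ?p - 1\<bar> \<le> norm e"
    using norm_triangle_ineq3[of ?p x] assms by simp
  then have "?p \<noteq> 0" using assms by auto
  then have "norm ?p *\<^sub>R sgn ?p = ?p"
    by (simp add: sgn_div_norm)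
  then have "sgn ?p - ?p = (1 - norm ?p) *\<^sub>R sgn ?p"
    by (simp add: scaleR_diff_left)
  then have "norm (sgn ?p - ?p) = \<bar>1 - norm ?p\<bar>"
    using \<open>?p \<noteq> 0\<close> by (simp add: norm_sgn)
  moreover have "norm (sgn ?p - x) \<le> norm (sgn ?p - ?p) + norm e"
    using norm_triangle_ineq[of "sgn ?p - ?p" e] by simp
  ultimately show ?thesis
    using p by (simp add: dist_norm)
qed

section \<open>A perturbation of the letter maps, its caps, and the prescribed map\<close>

locale perturbation =
  fixes \<psi> :: "letter \<Rightarrow> real^3 \<Rightarrow> real^3" and \<delta> :: real
  assumes cont: "continuous_on S2 (\<psi> l)"
    and \<psi>_S2 [simp]: "x \<in> S2 \<Longrightarrow> \<psi> l x \<in> S2"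
    and \<psi>_il [simp]: "x \<in> S2 \<Longrightarrow> \<psi> (il l) (\<psi> l x) = x"
    and close: "x \<in> S2 \<Longrightarrow> dist (\<psi> l x) (\<phi> l x) \<le> \<delta>"
    and \<delta>_pos: "0 < \<delta>" and \<delta>_small: "\<delta> \<le> 1 / 20000"
begin

lemma \<psi>_il2 [simp]: "x \<in> S2 \<Longrightarrow> \<psi> l (\<psi> (il l) x) = x"
  using \<psi>_il[of x "il l"] by simp

lemma close_inner:
  assumes "x \<in> S2"
  shows "\<bar>\<psi> l x \<bullet> dir m - \<phi> l x \<bullet> dir m\<bar> \<le> \<delta>"
proof -
  have "\<bar>(\<psi> l x - \<phi> l x) \<bullet> dir m\<bar> \<le> norm (\<psi> l x - \<phi> l x)"
    using Cauchy_Schwarz_ineq2[of "\<psi> l x - \<phi> l x" "dir m"] by simp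
  then show ?thesis
    using close[OF assms, of l] by (simp add: dist_norm inner_diff_left)
qed

text \<open>The caps of the negative letters are unperturbed; those of the positive letters are chosen so
  that \<open>\<psi> m\<close> maps the complement of \<open>cap (il m)\<close> exactly onto \<open>cap m\<close>.\<close>

definition cap :: "letter \<Rightarrow> (real^3) set" where
  "cap l = {x \<in> S2. if snd l then \<psi> (il l) x \<bullet> dir (il l) < 4 / 5 else 4 / 5 \<le> x \<bullet> dir l}"

lemma cap_S2: "x \<in> cap l \<Longrightarrow> x \<in> S2"
  by (simp add: cap_def)

lemma \<psi>_in_cap: "x \<in> S2 \<Longrightarrow> \<psi> m x \<in> cap m \<longleftrightarrow> x \<notin> cap (il m)"
proof -
  have "snd (il m) \<longleftrightarrow> \<not> snd m"
    by (simp add: inv_letter_def)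
  moreover assume "x \<in> S2"
  ultimately show ?thesis
    by (cases "snd m") (auto simp: cap_def)
qed

lemma cap_inner:
  assumes "x \<in> cap m"
  shows "79 / 100 < x \<bullet> dir m"
proof (cases "snd m")
  case True
  define y where "y = \<psi> (il m) x"
  have y: "y \<in> S2" "x = \<psi> m y" "- 4 / 5 < y \<bullet> dir m"
    using assms True by (auto simp: y_def cap_def)
  \<comment> \<open>In the coordinate along \<open>dir m\<close> the map \<open>\<phi> m\<close> is
    increasing and sends -4/5 to 4/5; the drop to 79/100 leaves room for \<delta>.\<close>
  have "79 / 100 + 1 / 20000 < \<phi> m y \<bullet> dir m"
    unfolding \<phi>_inner[OF y(1)] using y(3) by (subst pos_less_divide_eq) auto
  then show ?thesis
    using close_inner[OF y(1), of m m] \<delta>_small unfolding y(2) by linarith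
next
  case False
  then show ?thesis using assms by (simp add: cap_def)
qed

lemma not_cap_inner:
  assumes "x \<in> S2" "x \<notin> cap m"
  shows "x \<bullet> dir m < 805 / 1000"
proof (cases "snd m")
  case True
  define y where "y = \<psi> (il m) x"
  have y: "y \<in> S2" "x = \<psi> m y" "y \<bullet> dir m \<le> - 4 / 5"
    using assms True by (auto simp: y_def cap_def)
  have "\<phi> m y \<bullet> dir m < 805 / 1000 - 1 / 20000"
    unfolding \<phi>_inner[OF y(1)] using y(3) dir_inner_ge[OF y(1), of m] by (subst pos_divide_less_eq) auto
  then show ?thesis
    using close_inner[OF y(1), of m m] \<delta>_small unfolding y(2) by linarith
next
  case False
  then show ?thesis using assms by (simp add: cap_def)
qed

lemma cap_other: "x \<in> cap m \<Longrightarrow> l \<noteq> m \<Longrightarrow> x \<bullet> dir l < 63 / 100"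
  using cap_inner[of x m] cap_S2[of x m] by (intro inner_other_dir[of x m]) auto

lemma cap_unique: "x \<in> cap m \<Longrightarrow> x \<in> cap l \<Longrightarrow> l = m"
  using cap_other[of x m l] cap_inner[of x l] by force

text \<open>On a neighbourhood of the fundamental domain the conjugacy is prescribed as \<open>h0\<close>: the identity
  near the caps of the negative letters, \<open>\<phi> l \<circ> (\<psi> l)\<^sup>-\<^sup>1\<close> near those of the positive letters \<open>l\<close>, and
  an interpolation in between. These are the boundary conditions that equivariance imposes.\<close>

definition wgt :: "gen \<Rightarrow> real^3 \<Rightarrow> real" where
  "wgt g x = max 0 (min 1 (40 * (x \<bullet> dir (g, True) - 3 / 4)))"

definition err :: "gen \<Rightarrow> real^3 \<Rightarrow> real^3" where
  "err g x = \<phi> (g, True) (\<psi> (g, False) x) - x"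

definition corr :: "real^3 \<Rightarrow> real^3" where
  "corr x = wgt Gen_a x *\<^sub>R err Gen_a x + wgt Gen_b x *\<^sub>R err Gen_b x"

definition h0 :: "real^3 \<Rightarrow> real^3" where
  "h0 x = sgn (x + corr x)"

lemma il_pair [simp]: "il (g, b) = (g, \<not> b)"
  by (simp add: inv_letter_def)

text \<open>Seen from the pulled-back point, the error is a value of \<phi> - \<psi>, so
  \<open>close\<close>, and later the Lipschitz bound \<open>lip\<close>, apply to it
  directly.\<close>

lemma err_eq: "x \<in> S2 \<Longrightarrow> err g x = \<phi> (g, True) (\<psi> (g, False) x) - \<psi> (g, True) (\<psi> (g, False) x)"
  using \<psi>_il2[of x "(g, True)"] by (simp add: err_def)

lemma norm_err: "x \<in> S2 \<Longrightarrow> norm (err g x) \<le> \<delta>"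
  using close[of "\<psi> (g, False) x" "(g, True)"] by (simp add: err_eq dist_norm norm_minus_commute)

lemma wgt_bounds: "0 \<le> wgt g x" "wgt g x \<le> 1"
  by (auto simp: wgt_def)

lemma norm_wgt_err: "x \<in> S2 \<Longrightarrow> norm (wgt g x *\<^sub>R err g x) \<le> \<delta>"
  using mult_mono[OF wgt_bounds(2)[of g x] norm_err[of x g]] wgt_bounds[of g x] by simp

lemma norm_corr: "x \<in> S2 \<Longrightarrow> norm (corr x) \<le> 2 * \<delta>"
  unfolding corr_def
  using norm_triangle_mono[OF norm_wgt_err[of x Gen_a] norm_wgt_err[of x Gen_b]] by simp

lemma add_corr_nz: "x \<in> S2 \<Longrightarrow> x + corr x \<noteq> 0"
  using norm_corr[of x] \<delta>_small by (auto simp: S2_norm add_eq_0_iff)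

lemma h0_S2 [simp]: "x \<in> S2 \<Longrightarrow> h0 x \<in> S2"
  using add_corr_nz[of x] by (simp add: S2_norm h0_def norm_sgn)

lemma h0_close: "x \<in> S2 \<Longrightarrow> dist (h0 x) x \<le> 4 * \<delta>"
  using dist_sgn_le[of x "corr x"] norm_corr[of x] \<delta>_small by (simp add: S2_norm h0_def)

lemma continuous_on_h0: "continuous_on S2 h0"
proof -
  have "continuous_on S2 (\<lambda>x. \<phi> (g, True) (\<psi> (g, False) x))" for g
    by (rule continuous_on_compose2[OF continuous_on_\<phi> cont]) auto
  then show ?thesis
    unfolding h0_def corr_def wgt_def err_def
    by (intro continuous_intros continuous_on_sgn) (auto dest!: add_corr_nz simp: corr_def wgt_def err_def)
qed

lemma h0_id:
  assumes "x \<in> S2" "\<And>g. x \<bullet> dir (g, True) \<le> 3 / 4"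
  shows "h0 x = x"
proof -
  have "wgt g x = 0" for g
    using assms(2)[of g] by (simp add: wgt_def)
  then show ?thesis
    using assms(1) by (simp add: h0_def corr_def S2_norm sgn_div_norm)
qed

text \<open>The cutoff \<open>wgt g\<close> reaches 1 at 3/4 + 1/40 < 78/100, while the coordinate
  along the other positive direction is below 63/100 < 3/4. So only \<open>err g\<close> enters, and
  \<open>x + err g x\<close> already lies on the sphere, where \<open>sgn\<close> changes
  nothing.\<close>

lemma h0_near_cap:
  assumes "x \<in> S2" "78 / 100 < x \<bullet> dir (g, True)"
  shows "h0 x = \<phi> (g, True) (\<psi> (g, False) x)"
proof -
  have 1: "wgt g x = 1"
    using assms by (simp add: wgt_def)
  have 2: "wgt g' x = 0" if "g' \<noteq> g" for g'
    using inner_other_dir[OF assms, of "(g', True)"] that by (simp add: wgt_def)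
  have "corr x = err g x"
    using 1 2[of Gen_a] 2[of Gen_b] by (cases g) (simp_all add: corr_def)
  moreover have "norm (\<phi> (g, True) (\<psi> (g, False) x)) = 1"
    using assms by (simp flip: S2_norm)
  ultimately show ?thesis
    by (simp add: h0_def err_def sgn_div_norm)
qed

section \<open>The operator \<open>T\<close> and the class of maps that it preserves and
  contracts\<close>

definition T :: "(real^3 \<Rightarrow> real^3) \<Rightarrow> real^3 \<Rightarrow> real^3" where
  "T h x = (if \<exists>m. x \<in> cap m then let m = (THE m. x \<in> cap m) in \<phi> m (h (\<psi> (il m) x)) else h0 x)"

lemma T_cap:
  assumes "x \<in> cap m"
  shows "T h x = \<phi> m (h (\<psi> (il m) x))"
proof -
  have "(THE m. x \<in> cap m) = m"
    using assms cap_unique by blast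
  then show ?thesis using assms by (auto simp: T_def Let_def)
qed

lemma T_core: "(\<And>m. x \<notin> cap m) \<Longrightarrow> T h x = h0 x"
  by (simp add: T_def)

text \<open>A neighbourhood of the perturbed fundamental domain, on which \<open>T\<close> does not change the
  prescribed map.\<close>

definition N :: "(real^3) set" where
  "N = {x \<in> S2. \<forall>l. x \<bullet> dir l < 81 / 100}"

lemma core_N:
  assumes "x \<in> S2" "\<And>m. x \<notin> cap m"
  shows "x \<in> N"
proof -
  have "x \<bullet> dir l < 81 / 100" for l
    using not_cap_inner[OF assms, of l] by simp
  then show ?thesis using assms(1) by (simp add: N_def)
qed

text \<open>The radius 50\<delta> is reproduced by one step: a pull-back in the fundamental domain
  gives at most 9 * 4\<delta>, one in another cap at most 9/13 * 50\<delta>, and replacing \<psi> by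
  \<phi> costs one more \<delta>.\<close>

definition adm :: "(real^3 \<Rightarrow> real^3) \<Rightarrow> bool" where
  "adm h \<longleftrightarrow> (\<forall>x\<in>S2. h x \<in> S2 \<and> dist (h x) x \<le> 50 * \<delta>) \<and> (\<forall>x\<in>N. h x = h0 x) \<and> continuous_on S2 h"

lemma adm_h0: "adm h0"
  using continuous_on_h0 h0_close \<delta>_pos unfolding adm_def by force

lemma cap_pull:
  assumes "x \<in> cap m"
  shows "\<psi> (il m) x \<in> S2" "\<psi> (il m) x \<notin> cap (il m)"
proof -
  show y: "\<psi> (il m) x \<in> S2"
    using cap_S2[OF assms] by simp
  show "\<psi> (il m) x \<notin> cap (il m)"
    using \<psi>_in_cap[OF y, of m] assms cap_S2[OF assms] by simp
qed

text \<open>A point of \<open>N\<close> in \<open>cap m\<close> is near the boundary circle, so its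
  pull-back is near that of \<open>cap (il m)\<close> and lies in \<open>N\<close> again. One of
  \<open>m\<close> and \<open>il m\<close> is positive: \<open>h0\<close> is the identity on the
  negative side and \<phi> after the inverse of \<psi> on the positive side, and either way the step
  from one to the other reproduces \<open>h0\<close>.\<close>

lemma T_eq_h0:
  assumes h: "\<And>x. x \<in> N \<Longrightarrow> h x = h0 x" and x: "x \<in> N"
  shows "T h x = h0 x"
proof (cases "\<exists>m. x \<in> cap m")
  case True
  then obtain m where m: "x \<in> cap m" ..
  define y where "y = \<psi> (il m) x"
  have xS: "x \<in> S2" using m by (rule cap_S2)
  have y: "y \<in> S2" "y \<notin> cap (il m)" "\<psi> m y = x"
    using cap_pull[OF m] xS by (auto simp: y_def)
  have "x \<bullet> dir m < 81 / 100"
    using x by (simp add: N_def)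
  then have "78 / 100 + 1 / 20000 < \<phi> (il m) x \<bullet> dir (il m)"
    unfolding \<phi>_inner[OF xS] by (subst pos_less_divide_eq) auto
  then have near: "78 / 100 < y \<bullet> dir (il m)"
    using close_inner[OF xS, of "il m" "il m"] \<delta>_small unfolding y_def by linarith
  have other: "y \<bullet> dir l < 63 / 100" if "l \<noteq> il m" for l
    by (rule inner_other_dir[OF y(1) near that])
  have "y \<bullet> dir l < 81 / 100" for l
    using other[of l] not_cap_inner[OF y(1,2)] by (cases "l = il m") auto
  then have "y \<in> N" using y(1) by (simp add: N_def)
  then have Th: "T h x = \<phi> m (h0 y)"
    using T_cap[OF m] h by (simp add: y_def)
  obtain g b where gb: "m = (g, b)" by (cases m)
  show ?thesis
  proof (cases b)
    case True
    have "h0 y = y"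
    proof (rule h0_id[OF y(1)])
      show "y \<bullet> dir (g', True) \<le> 3 / 4" for g'
        using other[of "(g', True)"] True gb by simp
    qed
    moreover have "h0 x = \<phi> (g, True) (\<psi> (g, False) x)"
      using cap_inner[OF m] True gb by (intro h0_near_cap[OF xS]) auto
    ultimately show ?thesis
      using Th True gb by (simp add: y_def)
  next
    case False
    have "h0 y = \<phi> (g, True) (\<psi> (g, False) y)"
      using near False gb by (intro h0_near_cap[OF y(1)]) auto
    then have "T h x = x"
      using Th False gb y(3) xS \<phi>_il[OF xS, of "(g, True)"] by simp
    moreover have "h0 x = x"
    proof (rule h0_id[OF xS])
      show "x \<bullet> dir (g', True) \<le> 3 / 4" for g'
        using cap_other[OF m, of "(g', True)"] False gb by simp
    qed
    ultimately show ?thesis by simp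
  qed
qed (simp add: T_core)

text \<open>Being in another cap gives \<open>y \<bullet> dir m > - 63 / 100\<close>; a displacement
  by 100\<delta> \<le> 1/200 stays above -7/10, where the conformal factor is at most 9 / (41 - 28).
  The radius is 100\<delta>, not 50\<delta>, because injectivity compares two points with the same
  image.\<close>

lemma dist_\<phi>_contract:
  assumes "y \<in> cap m'" "m' \<noteq> il m" "z \<in> S2" "dist z y \<le> 100 * \<delta>" "w \<in> S2" "dist w y \<le> 100 * \<delta>"
  shows "dist (\<phi> m z) (\<phi> m w) \<le> 9 / 13 * dist z w"
proof -
  have "y \<bullet> dir (il m) < 63 / 100"
    using assms by (intro cap_other) auto
  then have y: "- 63 / 100 < y \<bullet> dir m" by simp
  have "- 7 / 10 \<le> v \<bullet> dir m" if "dist v y \<le> 100 * \<delta>" for v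
  proof -
    have "\<bar>(v - y) \<bullet> dir m\<bar> \<le> norm (v - y)"
      using Cauchy_Schwarz_ineq2[of "v - y" "dir m"] by simp
    then show ?thesis
      using y that \<delta>_small by (simp add: dist_norm inner_diff_left)
  qed
  from dist_\<phi>_le[OF assms(3,5) this this] assms show ?thesis by simp
qed

lemma dist_\<phi>_9: "x \<in> S2 \<Longrightarrow> y \<in> S2 \<Longrightarrow> dist (\<phi> l x) (\<phi> l y) \<le> 9 * dist x y"
  using dist_\<phi>_le[of x y "- 1" l] dir_inner_ge[of x l] dir_inner_ge[of y l] by simp

lemma adm_T:
  assumes h: "adm h"
  shows "adm (T h)"
proof -
  have hS: "h x \<in> S2" "dist (h x) x \<le> 50 * \<delta>" if "x \<in> S2" for x
    using h that by (auto simp: adm_def)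
  have hN: "h x = h0 x" if "x \<in> N" for x
    using h that by (auto simp: adm_def)
  have hc: "continuous_on S2 h"
    using h by (simp add: adm_def)
  have TN: "T h x = h0 x" if "x \<in> N" for x
    using T_eq_h0[OF hN that] by simp
  have "T h x \<in> S2 \<and> dist (T h x) x \<le> 50 * \<delta>" if x: "x \<in> S2" for x
  proof (cases "\<exists>m. x \<in> cap m")
    case True
    then obtain m where m: "x \<in> cap m" ..
    define y where "y = \<psi> (il m) x"
    have y: "y \<in> S2" "y \<notin> cap (il m)" "\<psi> m y = x"
      using cap_pull[OF m] x by (auto simp: y_def)
    have Th: "T h x = \<phi> m (h y)"
      using T_cap[OF m] by (simp add: y_def)
    \<comment> \<open>Near the isometric circle \<open>\<phi> m\<close> does not contract, but there \<open>h = h0\<close> is known.\<close>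
    have "dist (\<phi> m (h y)) (\<phi> m y) \<le> 49 * \<delta>"
    proof (cases "\<exists>m'. y \<in> cap m'")
      case True
      then obtain m' where m': "y \<in> cap m'" ..
      have "dist (\<phi> m (h y)) (\<phi> m y) \<le> 9 / 13 * dist (h y) y"
        using m' y hS[OF y(1)] \<delta>_pos by (intro dist_\<phi>_contract[of y m']) auto
      then show ?thesis
        using hS(2)[OF y(1)] \<delta>_pos by linarith
    next
      case False
      then have "h y = h0 y"
        using y(1) by (intro hN core_N) auto
      then show ?thesis
        using dist_\<phi>_9[of "h0 y" y m] h0_close[of y] y(1) \<delta>_pos by simp
    qed
    then have "dist (\<phi> m (h y)) x \<le> 50 * \<delta>"
      using close[OF y(1), of m] y(3) dist_triangle2[of "\<phi> m (h y)" x "\<phi> m y"]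
      by (simp add: dist_commute)
    then show ?thesis
      using Th hS[OF y(1)] by simp
  next
    case False
    then show ?thesis
      using h0_close[OF x] x \<delta>_pos by (simp add: T_core)
  qed
  moreover have "continuous_on S2 (T h)"
  proof (rule continuous_on_local)
    fix x assume x: "x \<in> S2"
    show "\<exists>U. open U \<and> x \<in> U \<and> continuous_on (S2 \<inter> U) (T h)"
    proof (cases "x \<in> N")
      case True
      define U where "U = (\<Inter>l. {x. x \<bullet> dir l < 81 / 100})"
      have "finite (UNIV :: letter set)"
      proof (rule finite_subset)
        show "(UNIV :: letter set) \<subseteq> {Gen_a, Gen_b} \<times> {True, False}"
          using gen.exhaust by auto
      qed simp
      then have "open U"
        unfolding U_def by (intro open_INT) (auto intro!: open_Collect_less continuous_intros)
      moreover have "S2 \<inter> U = N"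
        by (auto simp: U_def N_def)
      moreover have "continuous_on N (T h)"
        using continuous_on_subset[OF continuous_on_h0, of N] TN
        by (subst continuous_on_cong[OF refl TN]) (auto simp: N_def)
      ultimately show ?thesis
        using True by (intro exI[of _ U]) auto
    next
      case False
      then obtain l where l: "81 / 100 \<le> x \<bullet> dir l"
        using x by (auto simp: N_def not_less)
      \<comment> \<open>By \<open>not_cap_inner\<close> all of \<open>S2 \<inter> U\<close> lies in
        \<open>cap l\<close>, so a single formula describes \<open>T h\<close> there; 805/1000 <
        81/100 makes these sets cover everything outside \<open>N\<close>.\<close>
      define U where "U = {x. 805 / 1000 < x \<bullet> dir l}"
      have cap: "y \<in> cap l" if "y \<in> S2 \<inter> U" for y
        using not_cap_inner[of y l] that by (force simp: U_def)
      have "open U"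
        unfolding U_def by (intro open_Collect_less continuous_intros)
      moreover have "continuous_on (S2 \<inter> U) (T h)"
      proof (subst continuous_on_cong[OF refl T_cap[OF cap]])
        have "continuous_on S2 (\<lambda>y. \<phi> l (h (\<psi> (il l) y)))"
          by (intro continuous_on_compose2[OF continuous_on_\<phi>] continuous_on_compose2[OF hc] cont)
            (auto simp: hS)
        then show "continuous_on (S2 \<inter> U) (\<lambda>y. \<phi> l (h (\<psi> (il l) y)))"
          by (rule continuous_on_subset) auto
      qed
      ultimately show ?thesis
        using l by (intro exI[of _ U]) (auto simp: U_def)
    qed
  qed
  ultimately show ?thesis
    using TN by (simp add: adm_def)
qed

lemma T_contract:
  assumes h: "adm h" and k: "adm k" and r: "\<And>x. x \<in> S2 \<Longrightarrow> dist (h x) (k x) \<le> r" and x: "x \<in> S2"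
  shows "dist (T h x) (T k x) \<le> 9 / 13 * r"
proof -
  have r0: "0 \<le> r"
    using order_trans[OF zero_le_dist r[OF x]] .
  show ?thesis
  proof (cases "\<exists>m. x \<in> cap m")
    case True
    then obtain m where m: "x \<in> cap m" ..
    define y where "y = \<psi> (il m) x"
    have y: "y \<in> S2" "y \<notin> cap (il m)"
      using cap_pull[OF m] by (auto simp: y_def)
    show ?thesis
    proof (cases "\<exists>m'. y \<in> cap m'")
      case True
      then obtain m' where m': "y \<in> cap m'" ..
      have "dist (h y) y \<le> 50 * \<delta>" "dist (k y) y \<le> 50 * \<delta>" "h y \<in> S2" "k y \<in> S2"
        using h k y(1) by (auto simp: adm_def)
      then have "dist (\<phi> m (h y)) (\<phi> m (k y)) \<le> 9 / 13 * dist (h y) (k y)"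
        using m' y \<delta>_pos by (intro dist_\<phi>_contract[of y m']) auto
      then show ?thesis
        using r[OF y(1)] by (simp add: T_cap[OF m] y_def[symmetric])
    next
      case False
      then have "y \<in> N"
        using y(1) by (intro core_N) auto
      then show ?thesis
        using r0 h k by (simp add: T_cap[OF m] y_def[symmetric] adm_def)
    qed
  qed (simp add: T_core r0)
qed

section \<open>Convergence of the iterates to an equivariant map\<close>

definition hn :: "nat \<Rightarrow> real^3 \<Rightarrow> real^3" where
  "hn n = (T ^^ n) h0"

lemma hn_Suc: "hn (Suc n) = T (hn n)"
  by (simp add: hn_def)

lemma adm_hn: "adm (hn n)"
  by (induction n) (simp_all add: hn_def adm_h0 adm_T)

lemma dist_hn_Suc: "x \<in> S2 \<Longrightarrow> dist (hn (Suc n) x) (hn n x) \<le> (9 / 13) ^ n"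
proof (induction n arbitrary: x)
  case 0
  have "dist (hn 1 x) x \<le> 50 * \<delta>" "dist (hn 0 x) x \<le> 50 * \<delta>"
    using adm_hn 0 unfolding adm_def by blast+
  then show ?case
    using dist_triangle2[of "hn 1 x" "hn 0 x" x] \<delta>_small by simp
next
  case (Suc n)
  then show ?case
    using T_contract[OF adm_hn adm_hn Suc.IH Suc.prems] by (simp add: hn_Suc)
qed

lemma ex_limit: "\<exists>h. adm h \<and> (\<forall>x\<in>S2. T h x = h x)"
proof -
  \<comment> \<open>As a telescoping series with geometrically bounded terms, the iterates converge
    uniformly by the Weierstrass test.\<close>
  define f where "f n x = hn (Suc n) x - hn n x" for n x
  define h where "h x = h0 x + (\<Sum>n. f n x)" for x
  have "uniform_limit S2 (\<lambda>n x. \<Sum>i<n. f i x) (\<lambda>x. \<Sum>n. f n x) sequentially"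
  proof (rule Weierstrass_m_test)
    show "norm (f n x) \<le> (9 / 13) ^ n" if "x \<in> S2" for n x
      using dist_hn_Suc[OF that, of n] by (simp add: f_def dist_norm)
  qed (simp add: summable_geometric)
  then have "uniform_limit S2 (\<lambda>n x. h0 x + (\<Sum>i<n. f i x)) h sequentially"
    unfolding h_def by (intro uniform_limit_intros)
  moreover have "h0 x + (\<Sum>i<n. f i x) = hn n x" for n x
    unfolding f_def by (subst sum_lessThan_telescope) (simp add: hn_def)
  ultimately have u: "uniform_limit S2 hn h sequentially"
    by simp
  have lim: "(\<lambda>n. hn n x) \<longlonglongrightarrow> h x" if "x \<in> S2" for x
    using tendsto_uniform_limitI[OF u that] .
  have hnS: "hn n x \<in> S2" "dist (hn n x) x \<le> 50 * \<delta>" if "x \<in> S2" for n x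
    using adm_hn[of n] that by (auto simp: adm_def)
  have hS: "h x \<in> S2" if "x \<in> S2" for x
  proof (rule closed_sequentially[OF _ _ lim[OF that]])
    show "closed S2" by (simp add: S2_def)
  qed (simp add: hnS that)
  have "dist (h x) x \<le> 50 * \<delta>" if "x \<in> S2" for x
    using lim[OF that] hnS(2)[OF that]
    by (intro tendsto_upperbound[of "\<lambda>n. dist (hn n x) x"] tendsto_intros) auto
  moreover have "h x = h0 x" if "x \<in> N" for x
  proof (rule LIMSEQ_unique[OF lim])
    show "x \<in> S2" using that by (simp add: N_def)
    have "hn n x = h0 x" for n
      using adm_hn[of n] that by (simp add: adm_def)
    then show "(\<lambda>n. hn n x) \<longlonglongrightarrow> h0 x" by simp
  qed
  moreover have "continuous_on S2 h"
    using adm_hn by (intro uniform_limit_theorem[OF _ u]) (auto simp: adm_def)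
  ultimately have "adm h"
    using hS by (simp add: adm_def)
  moreover have "T h x = h x" if x: "x \<in> S2" for x
  proof (rule LIMSEQ_unique[OF _ LIMSEQ_Suc[OF lim[OF x]]])
    show "(\<lambda>n. hn (Suc n) x) \<longlonglongrightarrow> T h x"
    proof (cases "\<exists>m. x \<in> cap m")
      case True
      then obtain m where m: "x \<in> cap m" ..
      have "(\<lambda>n. \<phi> m (hn n (\<psi> (il m) x))) \<longlonglongrightarrow> \<phi> m (h (\<psi> (il m) x))"
        using x by (intro continuous_on_tendsto_compose[OF continuous_on_\<phi>] lim)
          (auto simp: hS hnS)
      then show ?thesis
        by (simp add: hn_Suc T_cap[OF m])
    qed (simp add: hn_Suc T_core)
  qed
  ultimately show ?thesis by blast
qed

text \<open>The fixed-point equation on \<open>cap m\<close> is equivariance for \<open>m\<close> at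
  points outside \<open>cap (il m)\<close>. At the remaining points it is the equation for
  \<open>il m\<close>, solved for the other side by inverting \<open>\<phi> (il m)\<close>.\<close>

lemma T_equivariant:
  assumes h: "adm h" "\<forall>x\<in>S2. T h x = h x" and y: "y \<in> S2"
  shows "h (\<psi> m y) = \<phi> m (h y)"
proof (cases "y \<in> cap (il m)")
  case False
  then have "T h (\<psi> m y) = \<phi> m (h (\<psi> (il m) (\<psi> m y)))"
    using y by (intro T_cap) (simp add: \<psi>_in_cap)
  then show ?thesis using y h(2) by simp
next
  case True
  from T_cap[OF True, of h] have "h y = \<phi> (il m) (h (\<psi> m y))"
    using h(2) y by simp
  moreover have "h (\<psi> m y) \<in> S2"
    using h(1) y by (simp add: adm_def)
  ultimately show ?thesis by simp
qed

end

section \<open>Injectivity under small Lipschitz perturbations\<close>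

text \<open>Equal projections mean \<open>x + e = r *\<^sub>R (y + f)\<close> for some
  \<open>r\<close>. Since \<open>x\<close> and \<open>y\<close> are unit vectors,
  \<open>D = norm (x - r *\<^sub>R y)\<close> bounds both \<open>\<bar>r - 1\<bar>\<close> and half
  of \<open>norm (x - y)\<close>; substituting gives D \<le> (1/4 + 1/10) D, hence D = 0.\<close>

lemma sgn_add_inj:
  fixes x y :: "'a::real_normed_vector"
  assumes "norm x = 1" "norm y = 1" "norm e \<le> 1 / 10" "norm f \<le> 1 / 10"
    and ef: "norm (e - f) \<le> 1 / 10 * norm (x - y)" and eq: "sgn (x + e) = sgn (y + f)"
  shows "x = y"
proof -
  define r where "r = norm (x + e) / norm (y + f)"
  have n: "\<bar>norm (x + e) - 1\<bar> \<le> 1 / 10" "\<bar>norm (y + f) - 1\<bar> \<le> 1 / 10"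
    using norm_triangle_ineq3[of "x + e" x] norm_triangle_ineq3[of "y + f" y] assms by auto
  then have pos: "norm (x + e) > 0" "norm (y + f) > 0" by linarith+
  have "norm (x + e) \<le> 5 / 4 * norm (y + f)"
    using n by linarith
  then have r: "0 \<le> r" "r \<le> 5 / 4"
    using pos(2) by (simp_all add: r_def pos_divide_le_eq)
  have "x + e = norm (x + e) *\<^sub>R sgn (x + e)"
    using pos by (simp add: sgn_div_norm)
  also have "\<dots> = r *\<^sub>R (y + f)"
    unfolding eq using pos by (simp add: r_def sgn_div_norm divide_inverse)
  finally have xy: "x - r *\<^sub>R y = - (r *\<^sub>R (e - f)) + (r - 1) *\<^sub>R e"
    by (simp add: algebra_simps)
  define D where "D = norm (x - r *\<^sub>R y)"
  have rD: "\<bar>r - 1\<bar> \<le> D"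
    using norm_triangle_ineq3[of x "r *\<^sub>R y"] assms r by (simp add: D_def)
  have "norm (x - y) = norm ((x - r *\<^sub>R y) + (r - 1) *\<^sub>R y)"
    by (simp add: algebra_simps)
  also have "\<dots> \<le> D + \<bar>r - 1\<bar>"
    unfolding D_def by (rule order_trans[OF norm_triangle_ineq]) (simp add: assms)
  finally have "norm (x - y) \<le> D + \<bar>r - 1\<bar>" .
  then have ef': "norm (e - f) \<le> 1 / 5 * D"
    using ef rD by linarith
  have "D \<le> r * norm (e - f) + \<bar>r - 1\<bar> * norm e"
    unfolding D_def xy using norm_triangle_ineq[of "- (r *\<^sub>R (e - f))" "(r - 1) *\<^sub>R e"] r by simp
  also have "\<dots> \<le> 5 / 4 * (1 / 5 * D) + D * (1 / 10)"
    using r ef' rD assms by (intro add_mono mult_mono) auto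
  finally have "D = 0"
    using rD by simp
  then show ?thesis
    using rD by (simp add: D_def)
qed

text \<open>Closeness of derivatives enters only as this Lipschitz bound on \<psi> - \<phi>;
  \<open>S2_lipschitz_of_deriv\<close> supplies it.\<close>

locale C1_perturbation = perturbation +
  fixes \<kappa> :: real
  assumes lip: "x \<in> S2 \<Longrightarrow> y \<in> S2 \<Longrightarrow> dist (\<psi> l x - \<phi> l x) (\<psi> l y - \<phi> l y) \<le> \<kappa> * dist x y"
    and \<kappa>_small: "\<kappa> \<le> 1 / 1000"
begin

lemma err_lip:
  assumes "x \<in> S2" "y \<in> S2"
  shows "norm (err g x - err g y) \<le> 1 / 90 * dist x y"
proof -
  define x' y' where "x' = \<psi> (g, False) x" and "y' = \<psi> (g, False) y"
  have S: "x' \<in> S2" "y' \<in> S2"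
    using assms by (auto simp: x'_def y'_def)
  have \<kappa>: "\<kappa> * dist u v \<le> 1 / 1000 * dist u v" for u v :: "real^3"
    using \<kappa>_small by (intro mult_right_mono) auto
  have "dist x' y' \<le> dist (\<phi> (g, False) x) (\<phi> (g, False) y)
      + dist (\<psi> (g, False) x - \<phi> (g, False) x) (\<psi> (g, False) y - \<phi> (g, False) y)"
    unfolding x'_def y'_def dist_norm
    using norm_triangle_ineq[of "\<phi> (g, False) x - \<phi> (g, False) y"
        "(\<psi> (g, False) x - \<phi> (g, False) x) - (\<psi> (g, False) y - \<phi> (g, False) y)"] by (simp add: algebra_simps)
  also have "\<dots> \<le> 9 * dist x y + 1 / 1000 * dist x y"
    by (intro add_mono dist_\<phi>_9 order_trans[OF lip \<kappa>] assms)
  finally have "dist x' y' \<le> 10 * dist x y"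
    using zero_le_dist[of x y] by linarith
  moreover have "norm (err g x - err g y) \<le> 1 / 1000 * dist x' y'"
    using order_trans[OF lip[OF S, of "(g, True)"] \<kappa>] assms
    by (simp add: err_eq x'_def y'_def dist_norm norm_minus_commute algebra_simps)
  ultimately show ?thesis
    using zero_le_dist[of x y] by linarith
qed

lemma wgt_lip: "\<bar>wgt g x - wgt g y\<bar> \<le> 40 * dist x y"
proof -
  have "\<bar>(x - y) \<bullet> dir (g, True)\<bar> \<le> dist x y"
    using Cauchy_Schwarz_ineq2[of "x - y" "dir (g, True)"] by (simp add: dist_norm)
  then show ?thesis
    by (auto simp: wgt_def inner_diff_left min_def max_def abs_if split: if_splits)
qed

text \<open>Product rule: 1/90 comes from the error itself and 40 / 20000 from the slope of the
  cutoff times the size of the error. Two such terms stay within the 1/10 allowed by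
  \<open>sgn_add_inj\<close>.\<close>

lemma wgt_err_lip:
  assumes "x \<in> S2" "y \<in> S2"
  shows "norm (wgt g x *\<^sub>R err g x - wgt g y *\<^sub>R err g y) \<le> 1 / 20 * dist x y"
proof -
  have "wgt g x *\<^sub>R err g x - wgt g y *\<^sub>R err g y
      = wgt g x *\<^sub>R (err g x - err g y) + (wgt g x - wgt g y) *\<^sub>R err g y"
    by (simp add: algebra_simps)
  then have "norm (wgt g x *\<^sub>R err g x - wgt g y *\<^sub>R err g y)
      \<le> wgt g x * norm (err g x - err g y) + \<bar>wgt g x - wgt g y\<bar> * norm (err g y)"
    using norm_triangle_ineq[of "wgt g x *\<^sub>R (err g x - err g y)" "(wgt g x - wgt g y) *\<^sub>R err g y"]
      wgt_bounds[of g x] by simp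
  also have "\<dots> \<le> 1 * (1 / 90 * dist x y) + (40 * dist x y) * (1 / 20000)"
    using wgt_bounds[of g x] wgt_lip[of g x y] err_lip[OF assms, of g] norm_err[OF assms(2), of g] \<delta>_small
    by (intro add_mono mult_mono) auto
  finally show ?thesis
    using zero_le_dist[of x y] by linarith
qed

lemma h0_inj:
  assumes "x \<in> S2" "y \<in> S2" "h0 x = h0 y"
  shows "x = y"
proof (rule sgn_add_inj[of x y "corr x" "corr y"])
  have "corr x - corr y = (wgt Gen_a x *\<^sub>R err Gen_a x - wgt Gen_a y *\<^sub>R err Gen_a y)
      + (wgt Gen_b x *\<^sub>R err Gen_b x - wgt Gen_b y *\<^sub>R err Gen_b y)"
    by (simp add: corr_def)
  then show "norm (corr x - corr y) \<le> 1 / 10 * norm (x - y)"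
    using norm_triangle_mono[OF wgt_err_lip[OF assms(1,2), of Gen_a] wgt_err_lip[OF assms(1,2), of Gen_b]]
    by (simp add: dist_norm)
qed (use assms norm_corr[of x] norm_corr[of y] \<delta>_small in \<open>auto simp: S2_norm h0_def\<close>)

text \<open>Two points with the same image stay \<open>100 * \<delta>\<close>-close along their orbits. Pulling them back
  expands their distance until they reach the fundamental domain, where \<open>h0\<close> is injective.\<close>

lemma conj_inj_bound:
  assumes h: "adm h" "\<forall>x\<in>S2. T h x = h x"
  shows "x \<in> S2 \<Longrightarrow> y \<in> S2 \<Longrightarrow> h x = h y \<Longrightarrow> dist x y \<le> (3 / 4) ^ n * (100 * \<delta>)"
proof (induction n arbitrary: x y)
  case 0
  then have "dist (h x) x \<le> 50 * \<delta>" "dist (h x) y \<le> 50 * \<delta>"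
    using h(1) by (auto simp: adm_def)
  then show ?case
    using dist_triangle3[of x y "h x"] by simp
next
  case (Suc n)
  have pow: "(3 / 4) ^ n * (100 * \<delta>) \<le> 100 * \<delta>"
    using \<delta>_pos by (simp add: power_le_one)
  \<comment> \<open>A point in the fundamental domain has coordinates below 805/1000, and its
    partner is 1/200-close, so both lie in \<open>N\<close>, where the conjugacy is the injective
    \<open>h0\<close>.\<close>
  have core: "u = v" if u: "u \<in> S2" "\<And>m. u \<notin> cap m" and v: "v \<in> S2" "h u = h v" for u v
  proof (rule h0_inj[OF u(1) v(1)])
    have "dist u v \<le> 1 / 200"
      using Suc.IH[OF u(1) v] pow \<delta>_small by linarith
    have "v \<bullet> dir l < 81 / 100" for l
    proof -
      have "\<bar>(v - u) \<bullet> dir l\<bar> \<le> dist u v"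
        using Cauchy_Schwarz_ineq2[of "v - u" "dir l"] by (simp add: dist_norm norm_minus_commute)
      then show ?thesis
        using not_cap_inner[OF u(1) u(2)[of l]] \<open>dist u v \<le> 1 / 200\<close> by (simp add: inner_diff_left)
    qed
    then have "v \<in> N"
      using v by (simp add: N_def)
    then show "h0 u = h0 v"
      using h(1) v(2) core_N[OF u] by (simp add: adm_def)
  qed
  show ?case
  proof (cases "\<exists>m. x \<in> cap m")
    case True
    then obtain m where m: "x \<in> cap m" ..
    define x' y' where "x' = \<psi> (il m) x" and "y' = \<psi> (il m) y"
    have S: "x' \<in> S2" "y' \<in> S2" and xy: "x = \<psi> m x'" "y = \<psi> m y'" and x': "x' \<notin> cap (il m)"
      using Suc.prems cap_pull[OF m] by (auto simp: x'_def y'_def)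
    have h': "h x' = h y'"
      using T_equivariant[OF h, of _ "il m"] Suc.prems by (simp add: x'_def y'_def)
    show ?thesis
    proof (cases "\<exists>m'. x' \<in> cap m'")
      case True
      then obtain m' where m': "x' \<in> cap m'" ..
      have "dist y' x' \<le> 100 * \<delta>"
        using Suc.IH[OF S h'] pow by (simp add: dist_commute)
      then have 1: "dist (\<phi> m x') (\<phi> m y') \<le> 9 / 13 * dist x' y'"
        using m' x' S \<delta>_pos by (intro dist_\<phi>_contract[of x' m']) auto
      have "dist x y \<le> dist (\<phi> m x') (\<phi> m y') + dist (\<psi> m x' - \<phi> m x') (\<psi> m y' - \<phi> m y')"
        unfolding xy dist_norm
        using norm_triangle_ineq[of "\<phi> m x' - \<phi> m y'" "(\<psi> m x' - \<phi> m x') - (\<psi> m y' - \<phi> m y')"]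
        by (simp add: algebra_simps)
      also have "\<dots> \<le> 9 / 13 * dist x' y' + 1 / 1000 * dist x' y'"
        using \<kappa>_small by (intro add_mono 1 order_trans[OF lip[OF S]] mult_right_mono) auto
      \<comment> \<open>The rate 3/4 exceeds 9/13 + 1/1000: contraction of \<phi> plus the Lipschitz
        constant of \<psi> - \<phi>.\<close>
      finally have "dist x y \<le> 3 / 4 * dist x' y'"
        using zero_le_dist[of x' y'] by linarith
      then show ?thesis
        using Suc.IH[OF S h'] unfolding power_Suc mult.assoc by linarith
    next
      case False
      then have "x' = y'"
        using core[OF S(1) _ S(2) h'] by blast
      then show ?thesis
        using xy \<delta>_pos by simp
    qed
  next
    case False
    then have "x = y"
      using core Suc.prems by blast
    then show ?thesis
      using \<delta>_pos by simp
  qed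
qed

lemma conj_inj:
  assumes h: "adm h" "\<forall>x\<in>S2. T h x = h x"
  shows "inj_on h S2"
proof (rule inj_onI)
  fix x y assume xy: "x \<in> S2" "y \<in> S2" "h x = h y"
  have "(\<lambda>n. (3 / 4) ^ n * (100 * \<delta>)) \<longlonglongrightarrow> 0 * (100 * \<delta>)"
    by (intro tendsto_mult LIMSEQ_realpow_zero tendsto_const) auto
  then have "dist x y \<le> 0 * (100 * \<delta>)"
    by (rule LIMSEQ_le_const) (use conj_inj_bound[OF h xy] in blast)
  then show "x = y" by simp
qed

end

section \<open>Surjectivity, and Lipschitz bounds from derivatives\<close>

text \<open>Closeness makes the map homotopic to the identity. If it missed \<open>p\<close>, it
  would never be antipodal to \<open>- p\<close>, hence also homotopic to that constant, and the
  sphere would be contractible. Both homotopies are straight segments avoiding 0, projected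
  radially.\<close>

lemma sphere_map_close_id_surj:
  fixes h :: "'a::euclidean_space \<Rightarrow> 'a"
  assumes c: "continuous_on (sphere 0 1) h" and S: "h ` sphere 0 1 \<subseteq> sphere 0 1"
    and close: "\<And>x. x \<in> sphere 0 1 \<Longrightarrow> dist (h x) x < 1"
  shows "h ` sphere 0 1 = sphere 0 1"
proof (rule ccontr)
  let ?S = "sphere (0::'a) 1"
  assume "h ` ?S \<noteq> ?S"
  then obtain p where p: "p \<in> ?S" "p \<notin> h ` ?S"
    using S by blast
  have seg: "0 \<notin> closed_segment u v" if "norm u = 1" "norm v = 1" "u \<noteq> - v" for u v :: 'a
  proof
    assume "0 \<in> closed_segment u v"
    then obtain t where t: "0 \<le> t" "t \<le> 1" "(1 - t) *\<^sub>R u + t *\<^sub>R v = 0"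
      by (auto simp: in_segment)
    then have *: "(1 - t) *\<^sub>R u = - (t *\<^sub>R v)"
      by (simp add: eq_neg_iff_add_eq_0)
    then have "norm ((1 - t) *\<^sub>R u) = norm (t *\<^sub>R v)"
      by simp
    then have "t = 1 / 2"
      using t that by simp
    then have "(1 / 2) *\<^sub>R u = (1 / 2) *\<^sub>R (- v)"
      using * unfolding \<open>t = 1 / 2\<close> by simp
    then show False
      using that by (simp only: scaleR_cancel_left) simp
  qed
  have "homotopic_with_canon (\<lambda>z. True) ?S (- {0}) id h"
  proof (rule homotopic_with_linear[OF continuous_on_id' c, folded id_def])
    fix x :: 'a assume x: "x \<in> ?S"
    have "x \<noteq> - h x"
    proof
      assume "x = - h x"
      then have "h x - x = - (2 *\<^sub>R x)"
        by (metis add_diff_cancel_right' diff_minus_eq_add minus_minus scaleR_2 minus_add_distrib add.commute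
            diff_conv_add_uminus)
      then show False
        using close[OF x] x by (simp add: dist_norm)
    qed
    moreover have "norm (h x) = 1"
      using subsetD[OF S imageI[OF x]] by simp
    ultimately show "closed_segment (id x) (h x) \<subseteq> - {0}"
      using seg[of x "h x"] x by auto
  qed
  moreover have "homotopic_with_canon (\<lambda>z. True) ?S (- {0}) h (\<lambda>x. - p)"
  proof (rule homotopic_with_linear[OF c continuous_on_const])
    fix x :: 'a assume x: "x \<in> ?S"
    have "h x \<noteq> p" "norm (h x) = 1"
      using p x subsetD[OF S imageI[OF x]] by auto
    then show "closed_segment (h x) (- p) \<subseteq> - {0}"
      using seg[of "h x" "- p"] p by auto
  qed
  ultimately have "homotopic_with_canon (\<lambda>z. True) ?S (- {0}) id (\<lambda>x. - p)"
    by (rule homotopic_with_trans)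
  then have "homotopic_with_canon (\<lambda>z. True) ?S ?S (sgn \<circ> id) (sgn \<circ> (\<lambda>x. - p))"
    by (rule homotopic_with_compose_continuous_left)
      (auto intro!: continuous_on_sgn continuous_intros simp: norm_sgn)
  moreover have "sgn \<circ> (\<lambda>x. - p) = (\<lambda>x::'a. - p)"
    using p by (simp add: fun_eq_iff sgn_div_norm)
  ultimately have "homotopic_with_canon (\<lambda>z. True) ?S ?S (sgn \<circ> id) (\<lambda>x. - p)"
    by simp
  then have "homotopic_with_canon (\<lambda>z. True) ?S ?S id (\<lambda>x. - p)"
    by (rule homotopic_with_eq) (auto simp: sgn_div_norm)
  then have "contractible ?S"
    unfolding contractible_def by blast
  then show False
    by (simp add: contractible_sphere)
qed

section \<open>Great circles and the mean value inequality on the sphere\<close>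

lemma sin_ge_quarter:
  assumes "0 \<le> t" "t \<le> pi / 2"
  shows "t / 4 \<le> sin (t::real)"
\<comment> \<open>Up to pi/3 the derivative of sine is at least 1/2; beyond, sine is at least 1/2
  while t/4 is at most pi/8.\<close>
proof (cases "t \<le> pi / 3")
  case True
  have "sin 0 - 0 / 4 \<le> sin t - t / 4"
  proof (rule DERIV_nonneg_imp_nondecreasing[OF assms(1)])
    fix x assume x: "0 \<le> x" "x \<le> t"
    have "cos (pi / 3) \<le> cos x"
      using x True assms by (intro cos_monotone_0_pi_le) auto
    then have "0 \<le> cos x - 1 / 4"
      by (simp add: cos_60)
    moreover have "((\<lambda>t. sin t - t / 4) has_real_derivative cos x - 1 / 4) (at x)"
      by (auto intro!: derivative_eq_intros)
    ultimately show "\<exists>y. ((\<lambda>t. sin t - t / 4) has_real_derivative y) (at x) \<and> 0 \<le> y"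
      by blast
  qed
  then show ?thesis by simp
next
  case False
  then have "sin (pi / 6) \<le> sin t"
    using assms by (intro sin_monotone_2pi_le) auto
  moreover have "t / 4 \<le> 1 / 2"
    using assms pi_less_4 by simp
  ultimately show ?thesis
    by (simp add: sin_30)
qed

lemma great_circle:
  fixes x y :: "'a::euclidean_space"
  assumes "norm x = 1" "norm y = 1" "2 \<le> DIM('a)"
  obtains v \<theta> where "norm v = 1" "x \<bullet> v = 0" "0 \<le> \<theta>" "\<theta> \<le> pi" "y = cos \<theta> *\<^sub>R x + sin \<theta> *\<^sub>R v"
    "\<theta> \<le> 4 * dist x y"
proof -
  define c where "c = x \<bullet> y"
  define w where "w = y - c *\<^sub>R x"
  define \<theta> where "\<theta> = arccos c"
  have xx: "x \<bullet> x = 1" "y \<bullet> y = 1"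
    using assms by (simp_all add: dot_square_norm)
  have c: "- 1 \<le> c" "c \<le> 1"
    using assms by (auto simp: c_def inner_unit_ge inner_unit_le)
  have \<theta>: "0 \<le> \<theta>" "\<theta> \<le> pi" "cos \<theta> = c" "0 \<le> sin \<theta>"
    using c by (auto simp: \<theta>_def arccos_lbound arccos_ubound intro: sin_ge_zero)
  have xw: "x \<bullet> w = 0"
    by (simp add: w_def inner_diff_right xx c_def)
  have "(norm w)\<^sup>2 = 1 - c\<^sup>2"
    unfolding power2_norm_eq_inner
    by (simp add: w_def inner_diff_right inner_diff_left xx c_def inner_commute[of y x] power2_eq_square)
  also have "\<dots> = (sin \<theta>)\<^sup>2"
    using sin_cos_squared_add[of \<theta>] \<theta>(3) by simp
  finally have nw: "norm w = sin \<theta>"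
    using \<theta>(4) by (simp add: power2_eq_iff_nonneg)
  obtain v where v: "norm v = 1" "x \<bullet> v = 0" "w = sin \<theta> *\<^sub>R v"
  proof (cases "w = 0")
    \<comment> \<open>Here \<open>y\<close> is \<open>x\<close> or \<open>- x\<close>, and every
      unit vector orthogonal to \<open>x\<close> serves; the dimension bound provides one.\<close>
    case True
    obtain u where u: "u \<noteq> 0" "orthogonal x u"
      using orthogonal_to_vector_exists[OF assms(3)] .
    show ?thesis
      by (rule that[of "sgn u"]) (use u True nw in \<open>auto simp: norm_sgn sgn_div_norm orthogonal_def\<close>)
  next
    case False
    show ?thesis
      by (rule that[of "sgn w"]) (use False xw in \<open>auto simp: norm_sgn sgn_div_norm nw[symmetric]\<close>)
  qed
  have "(dist x y)\<^sup>2 = 2 * (1 - cos \<theta>)"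
    using assms by (simp add: dist_norm norm_diff_unit_sq c_def[symmetric] \<theta>)
  also have "\<dots> = (2 * sin (\<theta> / 2))\<^sup>2"
    using cos_double_sin[of "\<theta> / 2"] by (simp add: power2_eq_square)
  finally have "dist x y = 2 * sin (\<theta> / 2)"
    by (rule power2_eq_imp_eq) (use sin_ge_zero[of "\<theta> / 2"] \<theta> in auto)
  then have "\<theta> \<le> 4 * dist x y"
    using sin_ge_quarter[of "\<theta> / 2"] \<theta> by simp
  moreover have "y = cos \<theta> *\<^sub>R x + sin \<theta> *\<^sub>R v"
    using v(3) \<theta>(3) by (simp add: w_def algebra_simps)
  ultimately show ?thesis
    using that v \<theta> by blast
qed

text \<open>A chord leaves the sphere, so the difference is estimated along a great-circle arc,
  whose velocity is a unit tangent vector. The factor 4 bounds the ratio of arc to chord.\<close>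

lemma S2_lipschitz_of_deriv:
  fixes f g :: "real^3 \<Rightarrow> real^3"
  assumes f: "\<And>x. x \<in> S2 \<Longrightarrow> f differentiable (at x within S2)"
    and g: "\<And>x. x \<in> S2 \<Longrightarrow> g differentiable (at x within S2)"
    and D: "\<And>x v. (x, v) \<in> unit_tangent_S2 \<Longrightarrow>
      dist (frechet_derivative f (at x within S2) v) (frechet_derivative g (at x within S2) v) \<le> \<delta>"
    and x: "x \<in> S2" and y: "y \<in> S2"
  shows "dist (f x - g x) (f y - g y) \<le> 4 * \<delta> * dist x y"
proof (cases "x = y")
  case False
  obtain v \<theta> where v: "norm v = 1" "x \<bullet> v = 0" and \<theta>: "0 \<le> \<theta>" and y': "y = cos \<theta> *\<^sub>R x + sin \<theta> *\<^sub>R v"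
    and \<theta>_le: "\<theta> \<le> 4 * dist x y"
    by (rule great_circle[of x y]) (use x y in \<open>auto simp: S2_norm\<close>)
  define c where "c t = cos t *\<^sub>R x + sin t *\<^sub>R v" for t
  define c' where "c' t = - sin t *\<^sub>R x + cos t *\<^sub>R v" for t
  have e: "x \<bullet> x = 1" "v \<bullet> v = 1" "x \<bullet> v = 0" "v \<bullet> x = 0"
    using x v by (auto simp: S2_norm dot_square_norm inner_commute)
  have c_S2: "c t \<in> S2" for t
    by (simp add: S2_norm norm_eq_1 c_def inner_add_left inner_add_right e flip: power2_eq_square)
  have UT: "(c t, c' t) \<in> unit_tangent_S2" for t
    using c_S2[of t] by (simp add: unit_tangent_S2_def c'_def c_def norm_eq_1 inner_add_left inner_add_right
        inner_diff_left inner_diff_right e flip: power2_eq_square)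
  have dc: "(c has_vector_derivative c' t) (at t)" for t
    unfolding c_def c'_def by (auto intro!: derivative_eq_intros)
  have chain: "((\<lambda>t. F (c t)) has_vector_derivative frechet_derivative F (at (c t) within S2) (c' t)) (at t)"
    if "\<And>x. x \<in> S2 \<Longrightarrow> F differentiable (at x within S2)" for F :: "real^3 \<Rightarrow> real^3" and t
  proof -
    have F: "(F has_derivative frechet_derivative F (at (c t) within S2)) (at (c t) within S2)"
      using that[OF c_S2] by (simp add: frechet_derivative_works)
    interpret L: bounded_linear "frechet_derivative F (at (c t) within S2)"
      using F by (rule has_derivative_bounded_linear)
    have "(F has_derivative frechet_derivative F (at (c t) within S2)) (at (c t) within range c)"
      using has_derivative_subset[OF F, of "range c"] c_S2 by auto
    from diff_chain_within[OF dc[unfolded has_vector_derivative_def] this]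
    show ?thesis
      by (simp add: has_vector_derivative_def o_def L.scaleR)
  qed
  define F where "F t = f (c t) - g (c t)" for t
  define F' where "F' t = frechet_derivative f (at (c t) within S2) (c' t)
      - frechet_derivative g (at (c t) within S2) (c' t)" for t
  have dF: "(F has_vector_derivative F' t) (at t)" for t
    unfolding F_def F'_def by (intro has_vector_derivative_diff chain[OF f] chain[OF g])
  have "\<theta> \<noteq> 0"
    using y' False by auto
  then have "norm (F \<theta> - F 0) \<le> \<delta> * \<theta> - \<delta> * 0"
  proof (intro differentiable_bound_general[where f' = F' and \<phi>' = "\<lambda>_. \<delta>"])
    show "continuous_on {0..\<theta>} F"
      by (intro continuous_at_imp_continuous_on ballI has_vector_derivative_continuous[OF dF])
    show "norm (F' t) \<le> \<delta>" for t
      using D[OF UT] by (simp add: F'_def dist_norm)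
  qed (use \<theta> dF in \<open>auto intro!: continuous_intros derivative_eq_intros\<close>)
  then have "dist (f x - g x) (f y - g y) \<le> \<delta> * \<theta>"
    by (simp add: F_def c_def y' dist_norm norm_minus_commute)
  also have "0 \<le> \<delta>"
    using order_trans[OF zero_le_dist D[OF UT[of 0]]] .
  then have "\<delta> * \<theta> \<le> \<delta> * (4 * dist x y)"
    using \<theta>_le by (rule mult_left_mono[rotated])
  finally show ?thesis by simp
qed simp

section \<open>The Schottky action\<close>

text \<open>The rational formula is its own ambient extension, on the open half-space where the
  denominator is positive; \<open>D\<close> is its derivative by the quotient rule.\<close>

lemma C1_on_boost:
  fixes u :: "'a::euclidean_space"
  assumes u: "norm u = 1"
  shows "C1_on (sphere 0 1) (boost u)"
proof -
  define U where "U = {x. 0 < 41 + 40 * (x \<bullet> u)}"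
  define D where "D x v = (1 / (41 + 40 * (x \<bullet> u))) *\<^sub>R (9 *\<^sub>R v + (32 * (v \<bullet> u)) *\<^sub>R u)
      - (40 * (v \<bullet> u) / (41 + 40 * (x \<bullet> u))\<^sup>2) *\<^sub>R (9 *\<^sub>R x + (32 * (x \<bullet> u) + 40) *\<^sub>R u)" for x v
  have D: "(boost u has_derivative D x) (at x)" if "x \<in> U" for x
    unfolding boost_def D_def using that
    by (auto intro!: derivative_eq_intros ext simp: U_def power2_eq_square divide_simps)
  have bl: "blinfun_apply (Blinfun (D x)) = D x" if "x \<in> U" for x
    using D[OF that] by (intro bounded_linear_Blinfun_apply has_derivative_bounded_linear)
  have "continuous_on U (\<lambda>x. Blinfun (D x))"
  proof (rule continuous_on_blinfun_componentwise)
    fix i :: 'a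
    have "continuous_on U (\<lambda>x. D x i)"
      unfolding D_def by (intro continuous_intros) (auto simp: U_def)
    then show "continuous_on U (\<lambda>x. blinfun_apply (Blinfun (D x)) i)"
      by (subst continuous_on_cong[OF refl bl[THEN fun_cong]]) 
  qed
  moreover have "open U"
    unfolding U_def by (intro open_Collect_less continuous_intros)
  moreover have "x \<in> U" if "x \<in> sphere 0 1" for x
    using inner_unit_ge[of x u] that u by (simp add: U_def)
  ultimately show ?thesis
    unfolding C1_on_def using D bl by (intro ballI exI[of _ U] exI[of _ "boost u"] exI[of _ "\<lambda>x. Blinfun (D x)"]) auto
qed

lemma homeomorphism_\<phi>: "homeomorphism S2 S2 (\<phi> l) (\<phi> (il l))"
  by (rule homeomorphismI) (auto simp: continuous_on_\<phi>)

definition schottky :: "letter list \<Rightarrow> real^3 \<Rightarrow> real^3" where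
  "schottky w x = foldr \<phi> w x"

lemma schottky_simps [simp]: "schottky [] x = x" "schottky (l # w) x = \<phi> l (schottky w x)"
  by (simp_all add: schottky_def)

lemma schottky_S2 [simp]: "x \<in> S2 \<Longrightarrow> schottky w x \<in> S2"
  by (induction w) auto

lemma schottky_push: "x \<in> S2 \<Longrightarrow> schottky (push l w) x = \<phi> l (schottky w x)"
  by (cases w) auto

lemma schottky_foldr_push: "x \<in> S2 \<Longrightarrow> schottky (foldr push u v) x = schottky u (schottky v x)"
  by (induction u) (auto simp: schottky_push)

lemma homeomorphism_schottky: "\<exists>k. homeomorphism S2 S2 (schottky w) k"
proof (induction w)
  case Nil
  have "schottky [] = (\<lambda>x. x)" by (simp add: fun_eq_iff)
  then show ?case
    by (auto intro!: exI[of _ "\<lambda>x. x"] homeomorphismI)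
next
  case (Cons l w)
  then obtain k where "homeomorphism S2 S2 (schottky w) k" ..
  from homeomorphism_compose[OF this homeomorphism_\<phi>[of l]]
  have "homeomorphism S2 S2 (\<phi> l \<circ> schottky w) (k \<circ> \<phi> (il l))" .
  moreover have "\<phi> l \<circ> schottky w = schottky (l # w)" by (simp add: fun_eq_iff)
  ultimately have "homeomorphism S2 S2 (schottky (l # w)) (k \<circ> \<phi> (il l))"
    by (simp only:)
  then show ?case
    by (rule exI[of "homeomorphism S2 S2 (schottky (l # w))"])
qed

lemma continuous_map_discrete_prod:
  assumes "\<And>g. g \<in> C \<Longrightarrow> continuous_map X Y (f g)"
  shows "continuous_map (prod_topology (discrete_topology C) X) Y (\<lambda>(g, x). f g x)"
  unfolding continuous_map_def
proof (intro conjI allI impI)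
  show "(\<lambda>(g, x). f g x) \<in> topspace (prod_topology (discrete_topology C) X) \<rightarrow> topspace Y"
    using assms by (auto simp: continuous_map_def)
  fix U assume U: "openin Y U"
  have "{p \<in> topspace (prod_topology (discrete_topology C) X). (\<lambda>(g, x). f g x) p \<in> U}
      = (\<Union>g\<in>C. {g} \<times> {x \<in> topspace X. f g x \<in> U})"
    by auto
  also have "openin (prod_topology (discrete_topology C) X) \<dots>"
    using assms U by (intro openin_Union) (auto simp: openin_prod_Times_iff continuous_map_def)
  finally show "openin (prod_topology (discrete_topology C) X)
      {p \<in> topspace (prod_topology (discrete_topology C) X). (\<lambda>(g, x). f g x) p \<in> U}" .
qed

lemma S_F2_letters: "S_F2 = range (\<lambda>l. [l])"
proof -
  have "(UNIV :: letter set) = {Gen_a, Gen_b} \<times> {True, False}"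
    using gen.exhaust by auto
  then show ?thesis
    by (auto simp: S_F2_def)
qed

lemma finite_S_F2: "finite S_F2"
  by (simp add: S_F2_def)

lemma schottky_Act1: "schottky \<in> Act1 F2 S_F2"
proof -
  have "continuous_map (top_of_set S2) (top_of_set S2) (schottky g)" for g
    using homeomorphism_schottky[of g] by (auto simp: homeomorphism_def)
  then have "schottky \<in> Act F2 S2"
    unfolding Act_def using homeomorphism_schottky
    by (auto intro!: continuous_map_discrete_prod simp: F2_def schottky_foldr_push)
  moreover have "C1_on S2 (schottky [l])" for l
  proof -
    have "schottky [l] = boost (dir l)"
      by (simp add: fun_eq_iff \<phi>_def)
    then show ?thesis
      by (simp add: S2_def C1_on_boost)
  qed
  ultimately show ?thesis
    by (auto simp: Act1_def S_F2_letters)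
qed

section \<open>Actions of the free group in terms of letters\<close>

lemma Act_letters:
  assumes A: "\<Psi> \<in> Act F2 S2"
  shows "continuous_on S2 (\<Psi> [l])" "x \<in> S2 \<Longrightarrow> \<Psi> [l] x \<in> S2"
    "x \<in> S2 \<Longrightarrow> \<Psi> [il l] (\<Psi> [l] x) = x"
    and Act_Nil: "x \<in> S2 \<Longrightarrow> \<Psi> [] x = x"
    and Act_Cons: "reduced_word (l # w) \<Longrightarrow> x \<in> S2 \<Longrightarrow> \<Psi> (l # w) x = \<Psi> [l] (\<Psi> w x)"
    and Act_S2: "reduced_word w \<Longrightarrow> x \<in> S2 \<Longrightarrow> \<Psi> w x \<in> S2"
proof -
  have hom: "\<exists>k. homeomorphism S2 S2 (\<Psi> w) k" if "reduced_word w" for w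
    using A that by (simp add: Act_def F2_def)
  have mult: "\<Psi> u (\<Psi> v x) = \<Psi> (foldr push u v) x" if "reduced_word u" "reduced_word v" "x \<in> S2" for u v x
    using A that by (simp add: Act_def F2_def)
  show S2: "\<Psi> w x \<in> S2" if "reduced_word w" "x \<in> S2" for w x
    using hom[OF that(1)] that(2) by (auto simp: homeomorphism_def)
  then show "x \<in> S2 \<Longrightarrow> \<Psi> [l] x \<in> S2" for x l
    by simp
  show "continuous_on S2 (\<Psi> [l])"
    using hom[of "[l]"] by (auto simp: homeomorphism_def)
  show Nil: "\<Psi> [] x = x" if x: "x \<in> S2" for x
  proof -
    obtain k where k: "homeomorphism S2 S2 (\<Psi> []) k"
      using hom[of "[]"] by auto
    \<comment> \<open>\<open>Act\<close> does not postulate that the neutral element acts trivially: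
      its map is idempotent and injective on the sphere, hence the identity there.\<close>
    have "k (\<Psi> [] (\<Psi> [] x)) = k (\<Psi> [] x)"
      using mult[of "[]" "[]" x] x by simp
    then show ?thesis
      using homeomorphism_apply1[OF k] S2[of "[]" x] x by simp
  qed
  show "\<Psi> [il l] (\<Psi> [l] x) = x" if x: "x \<in> S2" for x l
    using mult[of "[il l]" "[l]" x] Nil x by simp
  show "\<Psi> (l # w) x = \<Psi> [l] (\<Psi> w x)" if "reduced_word (l # w)" "x \<in> S2" for l w x
    using mult[of "[l]" w x] that by (simp add: push_reduced reduced_ConsD[of l w])
qed

lemma conjugacy_of_letters:
  assumes A: "\<Psi> \<in> Act F2 S2" and h: "\<And>m x. x \<in> S2 \<Longrightarrow> h (\<Psi> [m] x) = \<phi> m (h x)"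
    and w: "reduced_word w" and x: "x \<in> S2"
  shows "h (\<Psi> w x) = schottky w (h x)"
  using w
proof (induction w)
  case Nil
  then show ?case using Act_Nil[OF A x] by simp
next
  case (Cons l w)
  have w: "reduced_word w"
    using Cons.prems by (rule reduced_ConsD)
  have "h (\<Psi> (l # w) x) = h (\<Psi> [l] (\<Psi> w x))"
    by (subst Act_Cons[OF A Cons.prems x]) simp
  also have "\<dots> = \<phi> l (h (\<Psi> w x))"
    by (rule h) (rule Act_S2[OF A w x])
  finally show ?case
    using Cons.IH[OF w] by simp
qed

section \<open>Uniform distances and C0-stability\<close>

lemma dist_S2_le: "x \<in> S2 \<Longrightarrow> y \<in> S2 \<Longrightarrow> dist x y \<le> 2"
  using norm_triangle_ineq4[of x y] by (simp add: S2_norm dist_norm)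

text \<open>A real supremum is an upper bound only for a bounded set; the diameter 2 of the sphere
  bounds this one.\<close>

lemma dist_le_d_C0:
  assumes "f ` S2 \<subseteq> S2" "g ` S2 \<subseteq> S2" "x \<in> S2"
  shows "dist (f x) (g x) \<le> d_C0 S2 f g"
  unfolding d_C0_def
  by (rule cSUP_upper[OF assms(3)]) (use assms in \<open>auto intro!: bdd_aboveI2[of _ _ 2] dist_S2_le\<close>)

lemma d_C0_le:
  assumes "\<And>x. x \<in> S2 \<Longrightarrow> dist (f x) (g x) \<le> c"
  shows "d_C0 S2 f g \<le> c"
proof -
  have "axis 1 1 \<in> S2" by (simp add: S2_norm norm_axis_1)
  then show ?thesis
    unfolding d_C0_def by (intro cSUP_least) (use assms in auto)
qed

lemma perturbation_letters:
  assumes A: "\<Psi> \<in> Act F2 S2" and d: "\<And>l. d_C0 S2 (\<Psi> [l]) (schottky [l]) < \<delta>" and \<delta>: "0 < \<delta>" "\<delta> \<le> 1 / 20000"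
  shows "perturbation (\<lambda>l. \<Psi> [l]) \<delta>"
proof
  show "dist (\<Psi> [l] x) (\<phi> l x) \<le> \<delta>" if x: "x \<in> S2" for l x
  proof -
    have "\<Psi> [l] ` S2 \<subseteq> S2" "schottky [l] ` S2 \<subseteq> S2"
      using Act_letters(2)[OF A, of _ l] by auto
    then have "dist (\<Psi> [l] x) (schottky [l] x) \<le> d_C0 S2 (\<Psi> [l]) (schottky [l])"
      using x by (rule dist_le_d_C0)
    then show ?thesis using d[of l] by simp
  qed
qed (use Act_letters(1-3)[OF A] \<delta> in blast)+

lemma C0_stable_schottky: "C0_stable F2 S_F2 S2 schottky"
  unfolding C0_stable_def
proof (intro allI impI)
  fix \<epsilon> :: real assume \<epsilon>: "0 < \<epsilon>"
  \<comment> \<open>The conjugacy is 50\<delta>-close to the identity, and 50\<delta> \<le>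
    \<epsilon>/2.\<close>
  define \<delta> where "\<delta> = min (1 / 20000) (\<epsilon> / 100)"
  have \<delta>: "0 < \<delta>" "\<delta> \<le> 1 / 20000" "50 * \<delta> < \<epsilon>"
    using \<epsilon> by (auto simp: \<delta>_def min_def)
  have "\<exists>h. continuous_on S2 h \<and> h ` S2 = S2 \<and>
      (\<forall>g\<in>carrier F2. \<forall>x\<in>S2. h (\<Psi> g x) = schottky g (h x)) \<and> d_C0 S2 h id < \<epsilon>"
    if A: "\<Psi> \<in> Act F2 S2" and d: "d0 S_F2 S2 \<Psi> schottky < \<delta>" for \<Psi>
  proof -
    have "d_C0 S2 (\<Psi> [l]) (schottky [l]) < \<delta>" for l
      using d finite_S_F2 by (auto simp: d0_def S_F2_letters)
    then interpret perturbation "\<lambda>l. \<Psi> [l]" \<delta>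
      using \<delta> by (intro perturbation_letters[OF A]) auto
    obtain h where h: "adm h" "\<forall>x\<in>S2. T h x = h x"
      using ex_limit by blast
    have h': "continuous_on S2 h" "\<And>x. x \<in> S2 \<Longrightarrow> h x \<in> S2" "\<And>x. x \<in> S2 \<Longrightarrow> dist (h x) x \<le> 50 * \<delta>"
      using h(1) by (auto simp: adm_def)
    have "d_C0 S2 h id \<le> 50 * \<delta>"
      by (rule d_C0_le) (simp add: h')
    moreover have "dist (h x) x < 1" if "x \<in> S2" for x
      using h'(3)[OF that] \<delta>(2) by linarith
    then have "h ` S2 = S2"
      using h'(1,2) unfolding S2_def by (intro sphere_map_close_id_surj) auto
    moreover have "h (\<Psi> g x) = schottky g (h x)" if "g \<in> carrier F2" "x \<in> S2" for g x
      using that by (intro conjugacy_of_letters[OF A] T_equivariant[OF h]) (auto simp: F2_def)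
    ultimately show ?thesis
      using h'(1) \<delta>(3) by (intro exI[of _ h]) auto
  qed
  then show "\<exists>\<delta>>0. \<forall>\<Psi>\<in>Act F2 S2. d0 S_F2 S2 \<Psi> schottky < \<delta> \<longrightarrow> (\<exists>h. continuous_on S2 h \<and> h ` S2 = S2 \<and>
      (\<forall>g\<in>carrier F2. \<forall>x\<in>S2. h (\<Psi> g x) = schottky g (h x)) \<and> d_C0 S2 h id < \<epsilon>)"
    using \<delta>(1) by blast
qed

section \<open>Derivative distances and C1-stability\<close>

lemma C1_on_S2_deriv_bounded:
  assumes f: "C1_on S2 f"
  obtains B where "\<And>x v. (x, v) \<in> unit_tangent_S2 \<Longrightarrow> norm (frechet_derivative f (at x within S2) v) \<le> B"
proof -
  let ?D = "\<lambda>x v. frechet_derivative f (at x within S2) v"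
  have "\<exists>W B. open W \<and> x \<in> W \<and> (\<forall>y v. y \<in> W \<and> (y, v) \<in> unit_tangent_S2 \<longrightarrow> norm (?D y v) \<le> B)"
    if x: "x \<in> S2" for x
  proof -
    obtain U F and F' :: "real^3 \<Rightarrow> (real^3) \<Rightarrow>\<^sub>L (real^3)" where U: "open U" "x \<in> U"
      and F: "\<And>y. y \<in> U \<Longrightarrow> (F has_derivative blinfun_apply (F' y)) (at y)"
      and F': "continuous_on U F'" and Ff: "\<And>y. y \<in> U \<inter> S2 \<Longrightarrow> F y = f y"
      using f x unfolding C1_on_def by meson
    \<comment> \<open>Continuity of \<open>F'\<close> makes \<open>W\<close> an open neighbourhood
      of \<open>x\<close> with a derivative bound; compactness then leaves finitely many
      bounds.\<close>
    define W where "W = {y \<in> U. norm (F' y) < norm (F' x) + 1}"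
    obtain A where "open A" "A \<inter> U = W"
      unfolding W_def using open_Collect_less_Int[of U "\<lambda>y. norm (F' y)" "\<lambda>_. norm (F' x) + 1"] F'
      by (auto intro: continuous_intros)
    then have "open W"
      using U(1) by blast
    moreover have "norm (?D y v) \<le> norm (F' x) + 1" if y: "y \<in> W" and yv: "(y, v) \<in> unit_tangent_S2" for y v
    proof -
      have yU: "y \<in> U" "norm (F' y) < norm (F' x) + 1" and yS: "y \<in> S2" and v: "norm v = 1"
        using y yv by (auto simp: W_def unit_tangent_S2_def)
      obtain e where e: "0 < e" "ball y e \<subseteq> U"
        using U(1) yU(1) by (meson openE)
      have "(f has_derivative F' y) (at y within S2)"
        using e yS Ff by (intro has_derivative_transform_within[OF has_derivative_at_withinI[OF F[OF yU(1)]], of e])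
          (auto simp: subset_iff dist_commute)
      then have "?D y v = F' y v"
        using yv by (rule S2_derivative_unique)
      then show ?thesis
        using norm_blinfun[of "F' y" v] v yU(2) by simp
    qed
    ultimately show ?thesis
      using U(2) by (intro exI[of _ W] exI[of _ "norm (F' x) + 1"]) (auto simp: W_def)
  qed
  then obtain W B where W: "\<And>x. x \<in> S2 \<Longrightarrow> open (W x)" "\<And>x. x \<in> S2 \<Longrightarrow> x \<in> W x"
    and B: "\<And>x y v. x \<in> S2 \<Longrightarrow> y \<in> W x \<Longrightarrow> (y, v) \<in> unit_tangent_S2 \<Longrightarrow> norm (?D y v) \<le> B x"
    by metis
  have "compact S2" by (simp add: S2_def)
  then obtain C where C: "C \<subseteq> S2" "finite C" "S2 \<subseteq> (\<Union>c\<in>C. W c)"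
    by (rule compactE_image[of S2 S2 W]) (use W in auto)
  show ?thesis
  proof (rule that[of "Max (B ` C)"])
    fix x v assume xv: "(x, v) \<in> unit_tangent_S2"
    then obtain c where c: "c \<in> C" "x \<in> W c"
      using C(3) by (auto simp: unit_tangent_S2_def)
    then have "norm (?D x v) \<le> B c"
      using B[of c x v] xv C(1) by blast
    also have "\<dots> \<le> Max (B ` C)"
      using c C(2) by (intro Max_ge) auto
    finally show "norm (?D x v) \<le> Max (B ` C)" .
  qed
qed

text \<open>Boundedness of both derivatives, from compactness of the sphere, makes the supremum a
  genuine upper bound.\<close>

lemma dist_deriv_le_d_C0_deriv:
  assumes f: "C1_on S2 f" and g: "C1_on S2 g" and xv: "(x, v) \<in> unit_tangent_S2"
  shows "dist (frechet_derivative f (at x within S2) v) (frechet_derivative g (at x within S2) v)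
    \<le> d_C0_deriv f g"
proof -
  obtain B where B: "\<And>x v. (x, v) \<in> unit_tangent_S2 \<Longrightarrow> norm (frechet_derivative f (at x within S2) v) \<le> B"
    using C1_on_S2_deriv_bounded[OF f] by blast
  obtain C where C: "\<And>x v. (x, v) \<in> unit_tangent_S2 \<Longrightarrow> norm (frechet_derivative g (at x within S2) v) \<le> C"
    using C1_on_S2_deriv_bounded[OF g] by blast
  let ?d = "\<lambda>(x, v). dist (frechet_derivative f (at x within S2) v) (frechet_derivative g (at x within S2) v)"
  have "bdd_above (?d ` unit_tangent_S2)"
  proof (rule bdd_aboveI2[of _ _ "B + C"], clarify)
    fix x v assume "(x, v) \<in> unit_tangent_S2"
    from add_mono[OF B[OF this] C[OF this]]
    show "dist (frechet_derivative f (at x within S2) v) (frechet_derivative g (at x within S2) v) \<le> B + C"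
      unfolding dist_norm by (rule order_trans[OF norm_triangle_ineq4])
  qed
  from cSUP_upper[OF xv this] show ?thesis
    by (simp add: d_C0_deriv_def)
qed

lemma C1_stable_schottky: "C1_stable F2 S_F2 schottky"
  unfolding C1_stable_def
proof (intro exI[of _ "1 / 20000"] conjI ballI impI)
  fix \<Psi> assume "\<Psi> \<in> Act1 F2 S_F2" and d: "d1 S_F2 \<Psi> schottky < 1 / 20000"
  then have A: "\<Psi> \<in> Act F2 S2" and C1: "C1_on S2 (\<Psi> [l])" for l
    by (auto simp: Act1_def S_F2_letters)
  have C1': "C1_on S2 (schottky [l])" for l
    using schottky_Act1 by (auto simp: Act1_def S_F2_letters)
  have "d_C1 (\<Psi> [l]) (schottky [l]) \<le> d1 S_F2 \<Psi> schottky" for l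
    unfolding d1_def using finite_S_F2 by (intro Max_ge) (auto simp: S_F2_letters)
  then have d1_l: "d_C1 (\<Psi> [l]) (schottky [l]) < 1 / 20000" for l
    using d by (rule le_less_trans)
  have d': "d_C0 S2 (\<Psi> [l]) (schottky [l]) < 1 / 20000" "d_C0_deriv (\<Psi> [l]) (schottky [l]) < 1 / 20000" for l
    using d1_l[of l] unfolding d_C1_def max_less_iff_conj by blast+
  have D: "dist (frechet_derivative (\<Psi> [l]) (at x within S2) v) (frechet_derivative (schottky [l]) (at x within S2) v)
      \<le> 1 / 20000" if "(x, v) \<in> unit_tangent_S2" for l x v
    using dist_deriv_le_d_C0_deriv[OF C1 C1' that, of l l] d'(2)[of l] by linarith
  interpret perturbation "\<lambda>l. \<Psi> [l]" "1 / 20000"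
    using d'(1) by (intro perturbation_letters[OF A]) auto
  interpret C1_perturbation "\<lambda>l. \<Psi> [l]" "1 / 20000" "1 / 1000"
  proof
    fix x y l assume xy: "x \<in> S2" "y \<in> S2"
    have "dist (\<Psi> [l] x - schottky [l] x) (\<Psi> [l] y - schottky [l] y) \<le> 4 * (1 / 20000) * dist x y"
      by (intro S2_lipschitz_of_deriv C1_on_imp_differentiable[OF C1] C1_on_imp_differentiable[OF C1'] D xy)
    also have "\<dots> \<le> 1 / 1000 * dist x y"
      by (intro mult_right_mono) auto
    finally show "dist (\<Psi> [l] x - \<phi> l x) (\<Psi> [l] y - \<phi> l y) \<le> 1 / 1000 * dist x y"
      by simp
  qed simp
  obtain h where h: "adm h" "\<forall>x\<in>S2. T h x = h x"
    using ex_limit by blast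
  have h': "continuous_on S2 h" "\<And>x. x \<in> S2 \<Longrightarrow> h x \<in> S2" "\<And>x. x \<in> S2 \<Longrightarrow> dist (h x) x \<le> 50 * (1 / 20000)"
    using h(1) by (auto simp: adm_def)
  have "dist (h x) x < 1" if "x \<in> S2" for x
    using h'(3)[OF that] by simp
  then have "h ` S2 = S2"
    using h'(1,2) unfolding S2_def by (intro sphere_map_close_id_surj) auto
  then obtain k where "homeomorphism S2 S2 h k"
    using homeomorphism_compact[of S2 h S2] h'(1) conj_inj[OF h] by (auto simp: S2_def)
  moreover have "h (\<Psi> g x) = schottky g (h x)" if "g \<in> carrier F2" "x \<in> S2" for g x
    using that by (intro conjugacy_of_letters[OF A] T_equivariant[OF h]) (auto simp: F2_def)
  ultimately show "\<exists>h k. homeomorphism S2 S2 h k \<and> (\<forall>g\<in>carrier F2. \<forall>x\<in>S2. h (\<Psi> g x) = schottky g (h x))"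
    by blast
qed simp

section \<open>Failure of expansivity\<close>

lemma \<phi>_cap:
  assumes "x \<in> S2" "- 4 / 5 \<le> x \<bullet> dir l"
  shows "4 / 5 \<le> \<phi> l x \<bullet> dir l"
  unfolding \<phi>_inner[OF assms(1)] using assms(2) by (subst pos_le_divide_eq) auto

text \<open>Along a reduced word each letter \<open>l\<close> is applied at points with coordinate
  at least -4/5 along \<open>dir l\<close>, that is, outside its isometric circle, where the
  conformal factor is at most 1.\<close>

lemma schottky_nonexpanding:
  assumes x: "x \<in> S2" "\<And>l. x \<bullet> dir l \<le> 4 / 5" and y: "y \<in> S2" "\<And>l. y \<bullet> dir l \<le> 4 / 5"
    and w: "reduced_word w"
  shows "dist (schottky w x) (schottky w y) \<le> dist x y"
proof -
  have start: "- 4 / 5 \<le> z \<bullet> dir l" if "\<And>l. z \<bullet> dir l \<le> 4 / 5" for z l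
    using that[of "il l"] by simp
  \<comment> \<open>The last letter \<open>m\<close> applied has moved the point into its own cap.
    As the word is reduced, \<open>m\<close> differs from \<open>il l\<close>, so the point is far
    from the cap of \<open>il l\<close>.\<close>
  have key: "- 4 / 5 \<le> schottky w z \<bullet> dir l" if z: "z \<in> S2" "\<And>l. z \<bullet> dir l \<le> 4 / 5" and "reduced_word (l # w)" for z l w
    using that(3)
  proof (induction w arbitrary: l)
    case Nil
    then show ?case using start[OF z(2), of l] by simp
  next
    case (Cons m w)
    have "4 / 5 \<le> \<phi> m (schottky w z) \<bullet> dir m"
      using Cons z(1) by (intro \<phi>_cap) auto
    then have "\<phi> m (schottky w z) \<bullet> dir (il l) < 63 / 100"
      using Cons.prems z(1) by (intro inner_other_dir[of _ m]) auto
    then show ?case by simp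
  qed
  show ?thesis
    using w
  proof (induction w)
    case (Cons l w)
    have "dist (\<phi> l (schottky w x)) (\<phi> l (schottky w y)) \<le> 9 / (41 + 40 * (- 4 / 5)) * dist (schottky w x) (schottky w y)"
      using key[OF x Cons.prems] key[OF y Cons.prems] x(1) y(1) by (intro dist_\<phi>_le) auto
    then show ?case
      using Cons.IH[OF reduced_ConsD[OF Cons.prems]] by simp
  qed simp
qed

lemma not_expansive_schottky: "\<not> expansive F2 S2 schottky"
proof
  assume "expansive F2 S2 schottky"
  then obtain \<alpha> where \<alpha>: "0 < \<alpha>"
    and ex: "\<And>x y. x \<in> S2 \<Longrightarrow> y \<in> S2 \<Longrightarrow> x \<noteq> y \<Longrightarrow> \<exists>g\<in>carrier F2. dist (schottky g x) (schottky g y) > \<alpha>"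
    unfolding expansive_def by blast
  \<comment> \<open>The pole orthogonal to both axes is interior to the fundamental domain: all
    points within 4/5 of it satisfy the cap inequalities.\<close>
  define x :: "real^3" where "x = axis 3 1"
  have x: "x \<in> S2" "x \<bullet> dir l = 0" for l
    by (auto simp: x_def S2_norm norm_axis_1 dir_def inner_axis_axis split: gen.splits)
  have "x islimpt S2"
  proof (rule connected_imp_perfect[OF _ x(1)])
    show "connected S2"
      unfolding S2_def by (rule connected_sphere) simp
    have "(- x) $ 3 \<noteq> x $ 3"
      by (simp add: x_def axis_def)
    then have "- x \<noteq> x"
      by metis
    moreover have "- x \<in> S2"
      using x(1) by (simp add: S2_norm)
    ultimately show "S2 \<noteq> {z}" for z
      using x(1) by (metis singletonD)
  qed
  then obtain y where y: "y \<in> S2" "y \<noteq> x" "dist y x < min \<alpha> (4 / 5)"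
    using \<alpha> unfolding islimpt_approachable by (metis min_less_iff_conj zero_less_divide_iff zero_less_numeral)
  have "y \<bullet> dir l \<le> 4 / 5" for l
  proof -
    have "(y - x) \<bullet> dir l \<le> dist y x"
      using norm_cauchy_schwarz[of "y - x" "dir l"] by (simp add: dist_norm)
    then show ?thesis
      using y(3) x(2)[of l] by (simp add: inner_diff_left)
  qed
  then have "dist (schottky g x) (schottky g y) \<le> dist x y" if "g \<in> carrier F2" for g
    using that x y(1) by (intro schottky_nonexpanding) (auto simp: F2_def)
  moreover obtain g where "g \<in> carrier F2" "dist (schottky g x) (schottky g y) > \<alpha>"
    using ex[OF x(1) y(1)] y(2) by blast
  ultimately show False
    using y(3) by (force simp: dist_commute)
qed

theorem mainTheorem2:
  "\<exists>\<Phi>\<in>Act1 F2 S_F2. C0_stable F2 S_F2 S2 \<Phi> \<and> C1_stable F2 S_F2 \<Phi> \<and> \<not> expansive F2 S2 \<Phi>"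
  using schottky_Act1 C0_stable_schottky C1_stable_schottky not_expansive_schottky by blast

end
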